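(* Let $k\ge 3$ be an odd integer. A simple, connected, finite graph $G$ exhibits a $k$-periodic Grover walk if and only if $G$ is the cycle graph $C_k$ on $k$ vertices.
   Context: For a simple connected finite graph $G=(V,E)$, let $\mathcal{A}=\{(u,v),(v,u)\mid uv\in E\}$ be the set of arcs; for an arc $e=(u,v)$ write $o(e)=u$, $t(e)=v$, and $\bar e=(v,u)$. The Grover walk on $G$ has time evolution $U$ on $\mathbb{C}^{\mathcal{A}}$ with entries $U_{e,f}=2/\deg t(f)$ if $t(f)=o(e)$ and $e\neq\bar f$; $U_{e,f}=2/\deg t(f)-1$ if $e=\bar f$; and $U_{e,f}=0$ otherwise. $G$ is periodic if $U^m=I$ for some positive integer $m$; the least such $m$ is the period, and $G$ is called $k$-periodic if its period is $k$. *)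

theory Defs
  imports Complex_Main
begin

(* A simple graph: finite vertex set V, symmetric irreflexive adjacency E on V. *)
definition simple_graph :: "'a set \<Rightarrow> ('a \<Rightarrow> 'a \<Rightarrow> bool) \<Rightarrow> bool" where
  "simple_graph V E \<longleftrightarrow> finite V \<and> (\<forall>u v. E u v \<longrightarrow> u \<in> V \<and> v \<in> V)
     \<and> (\<forall>u v. E u v \<longrightarrow> E v u) \<and> (\<forall>v. \<not> E v v)"

(* connected: nonempty and any two vertices joined by a walk along E *)
definition connected_graph :: "'a set \<Rightarrow> ('a \<Rightarrow> 'a \<Rightarrow> bool) \<Rightarrow> bool" where
  "connected_graph V E \<longleftrightarrow> V \<noteq> {} \<and>
     (\<forall>u\<in>V. \<forall>v\<in>V. (u, v) \<in> {(x, y). E x y}\<^sup>*)"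

definition arcs :: "'a set \<Rightarrow> ('a \<Rightarrow> 'a \<Rightarrow> bool) \<Rightarrow> ('a \<times> 'a) set" where
  "arcs V E = {(u, v). u \<in> V \<and> v \<in> V \<and> E u v}"

definition deg :: "'a set \<Rightarrow> ('a \<Rightarrow> 'a \<Rightarrow> bool) \<Rightarrow> 'a \<Rightarrow> nat" where
  "deg V E v = card {u \<in> V. E v u}"

definition origin :: "'a \<times> 'a \<Rightarrow> 'a" where "origin e = fst e"
definition terminus :: "'a \<times> 'a \<Rightarrow> 'a" where "terminus e = snd e"
definition rev_arc :: "'a \<times> 'a \<Rightarrow> 'a \<times> 'a" where "rev_arc e = (snd e, fst e)"

(* Grover walk time evolution matrix U, indexed by arcs *)
definition grover :: "'a set \<Rightarrow> ('a \<Rightarrow> 'a \<Rightarrow> bool) \<Rightarrow> 'a \<times> 'a \<Rightarrow> 'a \<times> 'a \<Rightarrow> complex" where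
  "grover V E e f =
     (if terminus f = origin e \<and> e \<noteq> rev_arc f then 2 / of_nat (deg V E (terminus f))
      else if e = rev_arc f then 2 / of_nat (deg V E (terminus f)) - 1
      else 0)"

(* m-th power of a matrix indexed by the finite set A *)
fun mat_pow_on :: "'i set \<Rightarrow> ('i \<Rightarrow> 'i \<Rightarrow> complex) \<Rightarrow> nat \<Rightarrow> 'i \<Rightarrow> 'i \<Rightarrow> complex" where
  "mat_pow_on A M 0 e f = (if e = f then 1 else 0)"
| "mat_pow_on A M (Suc n) e f = (\<Sum>g\<in>A. M e g * mat_pow_on A M n g f)"

definition grover_pow_is_id :: "'a set \<Rightarrow> ('a \<Rightarrow> 'a \<Rightarrow> bool) \<Rightarrow> nat \<Rightarrow> bool" where
  "grover_pow_is_id V E m \<longleftrightarrow>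
     (\<forall>e\<in>arcs V E. \<forall>f\<in>arcs V E. mat_pow_on (arcs V E) (grover V E) m e f = (if e = f then 1 else 0))"

definition periodic :: "'a set \<Rightarrow> ('a \<Rightarrow> 'a \<Rightarrow> bool) \<Rightarrow> bool" where
  "periodic V E \<longleftrightarrow> (\<exists>m>0. grover_pow_is_id V E m)"

definition period :: "'a set \<Rightarrow> ('a \<Rightarrow> 'a \<Rightarrow> bool) \<Rightarrow> nat" where
  "period V E = (LEAST m. m > 0 \<and> grover_pow_is_id V E m)"

definition k_periodic :: "'a set \<Rightarrow> ('a \<Rightarrow> 'a \<Rightarrow> bool) \<Rightarrow> nat \<Rightarrow> bool" where
  "k_periodic V E k \<longleftrightarrow> periodic V E \<and> period V E = k"

(* G is (isomorphic to) the cycle graph C_k *)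
definition is_cycle_graph :: "'a set \<Rightarrow> ('a \<Rightarrow> 'a \<Rightarrow> bool) \<Rightarrow> nat \<Rightarrow> bool" where
  "is_cycle_graph V E k \<longleftrightarrow> (\<exists>\<phi>. bij_betw \<phi> {0..<k} V \<and>
     (\<forall>i<k. \<forall>j<k. E (\<phi> i) (\<phi> j) \<longleftrightarrow> (j = (i + 1) mod k \<or> i = (j + 1) mod k)))"

end

theory Submission
  imports "Jordan_Normal_Form.Determinant" Defs
begin

text \<open>Let \<open>U\<^sup>k = 1\<close> with \<open>k\<close> odd, and let \<open>S\<close> be the reversal of arcs. As \<open>S U S = U\<^sup>-\<^sup>1\<close> and \<open>U\<close> is
  a square in the group generated by it, \<open>U S\<close> is conjugate to \<open>S\<close>; comparing traces gives
  \<open>|E| = |V|\<close>. Functions of the terminus of an arc intertwine \<open>U + U\<^sup>-\<^sup>1\<close> with \<open>2P\<close>, where \<open>P\<close> is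
  the transition matrix of the simple random walk. On the complement of the eigenvalue \<open>1\<close>, which
  is simple for \<open>P\<close>, the operator \<open>1 + U\<close> has an inverse that is an integral polynomial in \<open>U\<close>, so the
  powers of the corresponding inverse of \<open>2 + 2P\<close> have bounded denominators. This forces
  \<open>det (2 + 2P) \<le> 4\<close>. On the other hand \<open>2 + 2P = 2 D\<^sup>-\<^sup>1 B B\<^sup>T\<close> with the degree matrix \<open>D\<close> and
  the square vertex-edge incidence matrix \<open>B\<close>, whose determinant is even and nonzero. Hence the
  product of the degrees is at least \<open>2\<^bsup>|V|\<^esup>\<close>; as their mean is \<open>2\<close>, all degrees are \<open>2\<close>.\<close>

section \<open>Determinants and integrality\<close>

lemma mat_mult_entry:
  assumes "A \<in> carrier_mat n n" "B \<in> carrier_mat n n" "i < n" "j < n"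
  shows "(A * B) $$ (i, j) = (\<Sum>l\<in>{0..<n}. A $$ (i, l) * B $$ (l, j))"
  using assms by (auto simp: scalar_prod_def intro!: sum.cong)

lemma det_in_Ints:
  fixes A :: "'a :: comm_ring_1 mat"
  assumes "A \<in> carrier_mat n n" "\<And>i j. i < n \<Longrightarrow> j < n \<Longrightarrow> A $$ (i, j) \<in> \<int>"
  shows "det A \<in> \<int>"
  unfolding det_def'[OF assms(1)]
  by (intro Ints_sum Ints_mult Ints_prod assms(2)) (auto simp: sign_def dest: permutes_in_image)

text \<open>The all-ones vector is an eigenvector with eigenvalue 1 plus the sum of the
  \<open>w j\<close>. Taking it as first basis vector (the columns of \<open>G\<close>) makes the
  matrix upper triangular, namely \<open>Y\<close>.\<close>

lemma det_add_rank_one: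
  fixes w :: "nat \<Rightarrow> 'a :: comm_ring_1"
  assumes "n > 0"
  shows "det (mat n n (\<lambda>(i, j). (if i = j then 1 else 0) + w j)) = 1 + (\<Sum>j\<in>{0..<n}. w j)"
proof -
  let ?M = "mat n n (\<lambda>(i, j). (if i = j then 1 else 0) + w j)"
  let ?W = "1 + (\<Sum>j\<in>{0..<n}. w j)"
  define G :: "'a mat" where "G = mat n n (\<lambda>(i, j). if i = j \<or> j = 0 then 1 else 0)"
  define Y where "Y = mat n n (\<lambda>(i, j). if i = 0 then (if j = 0 then ?W else w j) else if i = j then 1 else 0)"
  have carr: "?M \<in> carrier_mat n n" "G \<in> carrier_mat n n" "Y \<in> carrier_mat n n"
    by (auto simp: G_def Y_def)
  have "det G = prod_list (diag_mat G)"
    by (rule det_lower_triangular[OF _ carr(2)]) (auto simp: G_def)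
  then have G: "det G = 1" by (simp add: prod_list_diag_prod G_def)
  have "det Y = prod_list (diag_mat Y)"
    by (rule det_upper_triangular[OF _ carr(3)]) (auto simp: Y_def upper_triangular_def)
  also have "\<dots> = (\<Prod>i\<in>{0..<n}. if i = 0 then ?W else 1)"
    unfolding prod_list_diag_prod by (rule prod.cong) (auto simp: Y_def)
  finally have Y: "det Y = ?W" using assms by simp
  have "?M * G = G * Y"
  proof (rule eq_matI)
    fix i j assume "i < dim_row (G * Y)" "j < dim_col (G * Y)"
    then have ij: "i < n" "j < n" by (auto simp: G_def Y_def)
    have "(?M * G) $$ (i, j) = (\<Sum>l\<in>{0..<n}. (of_bool (i = l) + w l) * of_bool (l = j \<or> j = 0))"
      unfolding mat_mult_entry[OF carr(1,2) ij] using ij by (intro sum.cong) (auto simp: G_def)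
    also have "\<dots> = (if j = 0 then ?W else of_bool (i = j) + w j)"
      using ij by (auto simp: sum.distrib of_bool_def if_distrib[of "\<lambda>x. _ * x"] cong: if_cong)
    finally have l: "(?M * G) $$ (i, j) = (if j = 0 then ?W else of_bool (i = j) + w j)" .
    have "(G * Y) $$ (i, j) = (\<Sum>l\<in>{0..<n}. of_bool (l = 0) * Y $$ (0, j) + of_bool (l = i \<and> i \<noteq> 0) * Y $$ (i, j))"
      unfolding mat_mult_entry[OF carr(2,3) ij] using ij by (intro sum.cong) (auto simp: G_def)
    also have "\<dots> = Y $$ (0, j) + (if i \<noteq> 0 then Y $$ (i, j) else 0)"
      using ij assms by (auto simp: sum.distrib of_bool_def if_distrib[of "\<lambda>x. x * _"] cong: if_cong)
    finally show "(?M * G) $$ (i, j) = (G * Y) $$ (i, j)"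
      unfolding l using ij assms by (auto simp: Y_def)
  qed (auto simp: G_def Y_def)
  then have "det ?M * det G = det G * det Y"
    using det_mult[OF carr(1,2)] det_mult[OF carr(2,3)] by simp
  then show ?thesis by (simp add: G Y)
qed

text \<open>The numbers c x^j are positive integers, whereas they would tend to 0 if x were below 1.
  This turns bounded denominators of matrix powers into a bound on a determinant.\<close>

lemma one_le_of_integral_powers:
  fixes x c :: real
  assumes "x > 0" "c > 0" "\<And>j. c * x ^ j \<in> \<int>"
  shows "x \<ge> 1"
proof (rule ccontr)
  assume "\<not> x \<ge> 1"
  then obtain j where "x ^ j < 1 / c"
    using real_arch_pow_inv[of "1 / c" x] assms by auto
  then have "c * x ^ j < 1" using assms(2) by (simp add: field_simps)
  moreover have "c * x ^ j > 0" using assms by simp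
  ultimately show False using assms(3)[of j] by (auto elim!: Ints_cases)
qed

text \<open>This is the equality case of \<open>x \<le> 2\<^bsup>x - 1\<^esup>\<close> for positive integers.\<close>

lemma eq_2_of_prod_ge:
  fixes f :: "'b \<Rightarrow> nat"
  assumes fin: "finite V" and pos: "\<And>v. v \<in> V \<Longrightarrow> f v > 0"
    and sum: "(\<Sum>v\<in>V. f v) = 2 * card V" and prod: "(\<Prod>v\<in>V. f v) \<ge> 2 ^ card V"
    and v: "v \<in> V"
  shows "f v = 2"
proof -
  have le: "x \<le> 2 ^ (x - 1)" for x :: nat by (cases x) (auto simp: Suc_leI)
  have lt: "x < 2 ^ (x - 1)" if "x \<ge> 3" for x :: nat
    using that
  proof (induction x rule: dec_induct)
    case (step m)
    then have "Suc m < 2 * 2 ^ (m - 1)" by simp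
    also have "\<dots> = 2 ^ m" using step by (cases m) auto
    finally show ?case by simp
  qed simp
  \<comment> \<open>The exponents \<open>f v - 1\<close> add up to \<open>card V\<close>, so the
    bounds 2^(f v - 1) multiply to exactly 2^(card V), and a single strict inequality contradicts
    \<open>prod\<close>.\<close>
  have "(\<Sum>v\<in>V. f v - 1) + card V = (\<Sum>v\<in>V. (f v - 1) + 1)" by (simp only: sum.distrib card_eq_sum)
  also have "\<dots> = (\<Sum>v\<in>V. f v)" using pos by (intro sum.cong) force+
  finally have exps: "(\<Sum>v\<in>V. f v - 1) = card V" using sum by simp
  have f_le: "f u \<le> 2" if u: "u \<in> V" for u
  proof (rule ccontr)
    assume "\<not> f u \<le> 2"
    then have "f u < 2 ^ (f u - 1)" by (intro lt) simp
    moreover have "(\<Prod>v\<in>V - {u}. f v) \<le> (\<Prod>v\<in>V - {u}. 2 ^ (f v - 1))"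
      by (intro prod_mono conjI le) simp
    moreover have "(\<Prod>v\<in>V - {u}. 2 ^ (f v - 1)) > (0::nat)" by (simp add: prod_pos)
    ultimately have "f u * (\<Prod>v\<in>V - {u}. f v) < 2 ^ (f u - 1) * (\<Prod>v\<in>V - {u}. 2 ^ (f v - 1))"
      by (meson le_less_trans mult_le_mono2 mult_less_mono1)
    then have "(\<Prod>v\<in>V. f v) < (\<Prod>v\<in>V. 2 ^ (f v - 1))"
      using fin u by (simp add: prod.remove)
    also have "\<dots> = 2 ^ card V" by (simp only: exps flip: power_sum)
    finally show False using prod by simp
  qed
  \<comment> \<open>No value exceeds 2, so the truncated differences \<open>2 - f u\<close> are
    genuine; as the mean is 2, they all vanish.\<close>
  have "(\<Sum>u\<in>V. f u + (2 - f u)) = (\<Sum>u\<in>V. 2)"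
    using f_le by (intro sum.cong) auto
  then have "(\<Sum>u\<in>V. 2 - f u) = 0" using sum by (simp add: sum.distrib)
  then have "2 - f v = 0" using fin v by simp
  then show ?thesis using f_le[OF v] by simp
qed

section \<open>The Grover walk as an operator\<close>

text \<open>Together with connectedness, the existence of an arc makes every degree positive, so
  divisions by degrees are genuine.\<close>

locale nontrivial_connected_graph =
  fixes V :: "'a set" and E :: "'a \<Rightarrow> 'a \<Rightarrow> bool"
  assumes simple: "simple_graph V E"
    and connected: "connected_graph V E"
    and arcs_nonempty: "arcs V E \<noteq> {}"
begin

abbreviation A :: "('a \<times> 'a) set" where "A \<equiv> arcs V E"
abbreviation d :: "'a \<Rightarrow> nat" where "d \<equiv> Defs.deg V E"
definition nb :: "'a \<Rightarrow> 'a set" where "nb v = {u \<in> V. E v u}"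

lemma finite_V: "finite V" and E_sym: "E u v \<Longrightarrow> E v u" and E_irrefl: "\<not> E v v"
  and E_V: "E u v \<Longrightarrow> u \<in> V" "E u v \<Longrightarrow> v \<in> V"
  using simple unfolding simple_graph_def by blast+

lemma d_eq_card: "d v = card (nb v)"
  by (simp add: Defs.deg_def nb_def)

lemma finite_nb [simp]: "finite (nb v)"
  by (simp add: nb_def finite_V)

lemma in_nb: "u \<in> nb v \<longleftrightarrow> E v u"
  using E_V by (auto simp: nb_def)

lemma arcs_iff: "(u, v) \<in> A \<longleftrightarrow> E u v"
  using E_V by (auto simp: arcs_def)

lemma arcs_Sigma: "A = Sigma V nb"
  using E_V by (auto simp: arcs_def nb_def)

lemma finite_arcs [simp]: "finite A"
  by (simp add: arcs_Sigma finite_V)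

lemma swap_arcs_iff: "(v, u) \<in> A \<longleftrightarrow> (u, v) \<in> A"
  using E_sym by (auto simp: arcs_iff)

lemma arcs_D: "e \<in> A \<Longrightarrow> fst e \<in> V" "e \<in> A \<Longrightarrow> snd e \<in> V" "e \<in> A \<Longrightarrow> snd e \<in> nb (fst e)"
  "e \<in> A \<Longrightarrow> fst e \<in> nb (snd e)" "e \<in> A \<Longrightarrow> (snd e, fst e) \<in> A" "e \<in> A \<Longrightarrow> fst e \<noteq> snd e"
  using E_V E_sym E_irrefl by (cases e; force simp: arcs_iff in_nb)+

lemma arcs_V: "(u, v) \<in> A \<Longrightarrow> u \<in> V" "(u, v) \<in> A \<Longrightarrow> v \<in> V"
  using arcs_D by force+

lemma no_loop: "(v, v) \<notin> A"
  by (simp add: arcs_iff E_irrefl)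

lemma vertex_induct:
  assumes "u \<in> V" "v \<in> V" "Q u" and step: "\<And>x y. E x y \<Longrightarrow> Q x \<Longrightarrow> Q y"
  shows "Q v"
proof -
  have "(u, v) \<in> {(x, y). E x y}\<^sup>*"
    using connected assms(1,2) by (simp add: connected_graph_def)
  then show ?thesis
    by (induction rule: rtrancl_induct) (use assms in auto)
qed

lemma d_pos: assumes "v \<in> V" shows "d v > 0"
proof -
  obtain x y where xy: "E x y"
    using arcs_nonempty arcs_iff by (metis ex_in_conv surj_pair)
  have "\<exists>w. E v w"
    by (rule vertex_induct[of x v]) (use xy assms E_V E_sym in blast)+
  then show ?thesis
    by (metis d_eq_card card_gt_0_iff empty_iff finite_nb in_nb)
qed

lemma arc_into:
  assumes "v \<in> V"
  obtains u where "(u, v) \<in> A"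
proof -
  have "nb v \<noteq> {}" using d_pos[OF assms] by (auto simp: d_eq_card)
  then show ?thesis using that unfolding in_nb arcs_iff by (meson E_sym ex_in_conv in_nb)
qed

lemma sum_arcs_fst: "(\<Sum>e\<in>A. g e) = (\<Sum>v\<in>V. \<Sum>u\<in>nb v. g (v, u))"
  by (simp add: arcs_Sigma sum.Sigma finite_V)

lemma sum_arcs_swap: "(\<Sum>e\<in>A. g e) = (\<Sum>e\<in>A. g (snd e, fst e))"
  by (rule sum.reindex_bij_witness[of _ "\<lambda>e. (snd e, fst e)" "\<lambda>e. (snd e, fst e)"])
     (auto simp: arcs_D)

lemma sum_arcs_into:
  assumes "v \<in> V"
  shows "(\<Sum>f\<in>A. if snd f = v then g f else 0) = (\<Sum>u\<in>nb v. g (u, v))"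
proof -
  have "(\<Sum>f\<in>A. if snd f = v then g f else 0) = (\<Sum>f\<in>{f\<in>A. snd f = v}. g f)"
    by (simp add: sum.inter_filter)
  also have "\<dots> = (\<Sum>u\<in>nb v. g (u, v))"
    by (rule sum.reindex_bij_witness[of _ "\<lambda>u. (u, v)" fst])
       (auto simp: arcs_D arcs_iff in_nb E_sym)
  finally show ?thesis .
qed

text \<open>The case distinction of the matrix collapses into an averaging part minus the arc
  reversal, since the reverse of an arc also ends at its origin.\<close>

lemma grover_arcs:
  assumes "e \<in> A" "f \<in> A"
  shows "grover V E e f = (if snd f = fst e then 2 / of_nat (d (fst e)) else 0)
           - (if f = (snd e, fst e) then 1 else 0)"
  using assms by (cases e; cases f)
    (auto simp: grover_def terminus_def origin_def rev_arc_def)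

text \<open>This is U acting on functions. The value 0 off the arcs lets identities between
  \<open>supported\<close> functions be stated as plain equalities.\<close>

definition step :: "('a \<times> 'a \<Rightarrow> complex) \<Rightarrow> 'a \<times> 'a \<Rightarrow> complex" where
  "step g e = (if e \<in> A then \<Sum>f\<in>A. grover V E e f * g f else 0)"

lemma step_eq:
  assumes "e \<in> A"
  shows "step g e = 2 / of_nat (d (fst e)) * (\<Sum>u\<in>nb (fst e). g (u, fst e)) - g (snd e, fst e)"
proof -
  have "step g e = (\<Sum>f\<in>A. (if snd f = fst e then 2 / of_nat (d (fst e)) * g f else 0)
                     - (if f = (snd e, fst e) then g f else 0))"
    using assms by (auto simp: step_def grover_arcs left_diff_distrib intro!: sum.cong)
  also have "\<dots> = (\<Sum>f\<in>A. if snd f = fst e then 2 / of_nat (d (fst e)) * g f else 0) - g (snd e, fst e)"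
    using assms by (simp add: sum_subtractf arcs_D)
  finally show ?thesis
    using assms by (simp add: sum_arcs_into arcs_D sum_distrib_left)
qed

lemma step_outside: "e \<notin> A \<Longrightarrow> step g e = 0"
  by (simp add: step_def)

lemma step_add: "step (\<lambda>e. g e + h e) = (\<lambda>e. step g e + step h e)"
  by (auto simp: step_def ring_distribs sum.distrib)

lemma step_minus: "step (\<lambda>e. - g e) = (\<lambda>e. - step g e)"
  by (auto simp: step_def sum_negf)

lemma step_zero: "step (\<lambda>e. 0) = (\<lambda>e. 0)"
  by (auto simp: step_def)

lemma step_sum: "finite I \<Longrightarrow> step (\<lambda>e. \<Sum>i\<in>I. g i e) = (\<lambda>e. \<Sum>i\<in>I. step (g i) e)"
  by (induction rule: finite_induct) (simp_all add: step_add step_zero)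

lemma steps_add: "(step ^^ i) (\<lambda>e. g e + h e) = (\<lambda>e. (step ^^ i) g e + (step ^^ i) h e)"
  by (induction i) (auto simp: step_add)

lemma steps_minus: "(step ^^ i) (\<lambda>e. - g e) = (\<lambda>e. - (step ^^ i) g e)"
  by (induction i) (auto simp: step_minus)

lemma steps_sum: "finite I \<Longrightarrow> (step ^^ j) (\<lambda>e. \<Sum>i\<in>I. g i e) = (\<lambda>e. \<Sum>i\<in>I. (step ^^ j) (g i) e)"
  by (induction j) (auto simp: step_sum)

lemma steps_mat_pow:
  "e \<in> A \<Longrightarrow> (step ^^ i) g e = (\<Sum>f\<in>A. mat_pow_on A (grover V E) i e f * g f)"
proof (induction i arbitrary: e)
  case 0
  then show ?case by (simp add: if_distrib[of "\<lambda>x. x * _"] cong: if_cong)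
next
  case (Suc i)
  have "(step ^^ Suc i) g e = (\<Sum>x\<in>A. grover V E e x * (\<Sum>f\<in>A. mat_pow_on A (grover V E) i x f * g f))"
    using Suc.prems by (simp add: Suc.IH step_def[of "(step ^^ i) g"])
  also have "\<dots> = (\<Sum>x\<in>A. \<Sum>f\<in>A. grover V E e x * mat_pow_on A (grover V E) i x f * g f)"
    by (simp add: sum_distrib_left mult.assoc)
  also have "\<dots> = (\<Sum>f\<in>A. \<Sum>x\<in>A. grover V E e x * mat_pow_on A (grover V E) i x f * g f)"
    by (rule sum.swap)
  finally show ?case by (simp add: sum_distrib_right)
qed

definition reverse :: "('a \<times> 'a \<Rightarrow> complex) \<Rightarrow> 'a \<times> 'a \<Rightarrow> complex" where
  "reverse g e = g (snd e, fst e)"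

lemma reverse_sum: "reverse (\<lambda>e. \<Sum>i\<in>I. g i e) = (\<lambda>e. \<Sum>i\<in>I. reverse (g i) e)"
  by (simp add: reverse_def fun_eq_iff)

definition supported :: "('a \<times> 'a \<Rightarrow> complex) \<Rightarrow> bool" where
  "supported g \<longleftrightarrow> (\<forall>e. e \<notin> A \<longrightarrow> g e = 0)"

lemma supported_step [simp]: "supported (step g)"
  by (simp add: supported_def step_def)

lemma supported_steps [simp]: "supported g \<Longrightarrow> supported ((step ^^ i) g)"
  by (cases i) auto

lemma supported_ext: "supported g \<Longrightarrow> supported h \<Longrightarrow> (\<And>e. e \<in> A \<Longrightarrow> g e = h e) \<Longrightarrow> g = h"
  by (rule ext) (metis supported_def)

text \<open>This is U S U = S, equivalent to S U S being the inverse of U. On the arcs at a vertex,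
  U replaces each incoming value by its reflection about their mean; the mean is preserved, so
  reflecting again restores the values.\<close>

lemma step_reverse_step:
  assumes "supported g"
  shows "step (reverse (step g)) = reverse g"
proof (rule supported_ext)
  show "supported (reverse g)"
    using assms swap_arcs_iff by (auto simp: supported_def reverse_def)
  fix e assume e: "e \<in> A"
  let ?v = "fst e"
  have dv: "of_nat (d ?v) \<noteq> (0::complex)" using d_pos e arcs_D by simp
  let ?S = "\<Sum>u\<in>nb ?v. g (u, ?v)"
  have *: "step g (?v, u) = 2 / of_nat (d ?v) * ?S - g (u, ?v)" if "u \<in> nb ?v" for u
    using step_eq[of "(?v, u)" g] that by (simp add: in_nb arcs_iff)
  have "(\<Sum>u\<in>nb ?v. step g (?v, u)) = ?S"
    using dv by (simp add: * sum_subtractf d_eq_card)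
  then show "step (reverse (step g)) e = reverse g e"
    using e *[of "snd e"] arcs_D by (simp add: step_eq reverse_def)
qed simp

lemma steps_reverse_steps:
  assumes "supported g"
  shows "(step ^^ i) (reverse ((step ^^ i) g)) = reverse g"
  using assms
proof (induction i arbitrary: g)
  case (Suc i)
  have "(step ^^ Suc i) (reverse ((step ^^ Suc i) g)) = step ((step ^^ i) (reverse ((step ^^ i) (step g))))"
    by (simp add: funpow_swap1)
  then show ?case using Suc by (simp add: step_reverse_step)
qed simp

text \<open>The reflection about the mean preserves the sum at each vertex, hence the total.\<close>

lemma sum_step: "(\<Sum>e\<in>A. step g e) = (\<Sum>e\<in>A. g e)"
proof -
  have "(\<Sum>e\<in>A. step g e) = (\<Sum>v\<in>V. \<Sum>u\<in>nb v. step g (v, u))"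
    by (rule sum_arcs_fst)
  also have "\<dots> = (\<Sum>v\<in>V. \<Sum>u\<in>nb v. g (u, v))"
  proof (rule sum.cong)
    fix v assume v: "v \<in> V"
    have dv: "of_nat (d v) \<noteq> (0::complex)" using d_pos v by simp
    have "step g (v, u) = 2 / of_nat (d v) * (\<Sum>u\<in>nb v. g (u, v)) - g (u, v)" if "u \<in> nb v" for u
      using step_eq[of "(v, u)" g] that by (simp add: in_nb arcs_iff)
    then show "(\<Sum>u\<in>nb v. step g (v, u)) = (\<Sum>u\<in>nb v. g (u, v))"
      using dv by (simp add: sum_subtractf d_eq_card)
  qed simp
  also have "\<dots> = (\<Sum>e\<in>A. g e)"
    by (subst sum_arcs_swap) (simp add: sum_arcs_fst)
  finally show ?thesis .
qed

lemma sum_steps: "(\<Sum>e\<in>A. (step ^^ i) g e) = (\<Sum>e\<in>A. g e)"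
  by (induction i) (auto simp: sum_step)

section \<open>Functions of the terminus and the simple random walk\<close>

definition at_terminus :: "('a \<Rightarrow> complex) \<Rightarrow> 'a \<times> 'a \<Rightarrow> complex" where
  "at_terminus p e = (if e \<in> A then p (snd e) else 0)"

text \<open>This is 2 + 2P, that is, twice the signless Laplacian (degree matrix plus adjacency
  matrix) with each row divided by the degree.\<close>

definition signless :: "('a \<Rightarrow> complex) \<Rightarrow> 'a \<Rightarrow> complex" where
  "signless p v = 2 * p v + 2 / of_nat (d v) * (\<Sum>u\<in>nb v. p u)"

lemma supported_at_terminus [simp]: "supported (at_terminus p)"
  by (simp add: supported_def at_terminus_def)

text \<open>All arcs into a vertex carry the same value, which reflection about the mean leaves
  unchanged; it moves to the outgoing arcs.\<close>

lemma step_at_terminus: "step (at_terminus p) = reverse (at_terminus p)"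
proof (rule supported_ext)
  show "supported (reverse (at_terminus p))"
    using swap_arcs_iff by (auto simp: supported_def reverse_def at_terminus_def)
  fix e assume e: "e \<in> A"
  have "d (fst e) > 0" "nb (fst e) \<noteq> {}" using d_pos arcs_D[OF e] by auto
  moreover have "(u, fst e) \<in> A" if "u \<in> nb (fst e)" for u
    using that by (simp add: in_nb arcs_iff E_sym)
  ultimately show "step (at_terminus p) e = reverse (at_terminus p) e"
    using e arcs_D(5)[OF e] by (simp add: step_eq at_terminus_def reverse_def d_eq_card)
qed simp

text \<open>The relation between the inverse of U, U itself and 2P, multiplied by U to avoid the
  inverse: (1 + U)^2 on functions of the terminus corresponds to U after 2 + 2P.\<close>

lemma signless_step:
  "at_terminus p e + 2 * step (at_terminus p) e + step (step (at_terminus p)) e = step (at_terminus (signless p)) e"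
proof (cases "e \<in> A")
  case True
  have "(u, fst e) \<in> A" "(fst e, u) \<in> A" if "u \<in> nb (fst e)" for u
    using that by (simp_all add: in_nb arcs_iff E_sym)
  then have "step (step (at_terminus p)) e = 2 / of_nat (d (fst e)) * (\<Sum>u\<in>nb (fst e). p u) - p (snd e)"
    using True arcs_D(5)[OF True] by (simp add: step_at_terminus step_eq reverse_def at_terminus_def)
  then show ?thesis
    using True arcs_D(5)[OF True]
    by (simp add: step_at_terminus reverse_def at_terminus_def signless_def)
qed (simp add: step_outside at_terminus_def)

lemma sum_at_terminus: "(\<Sum>e\<in>A. at_terminus p e) = (\<Sum>v\<in>V. of_nat (d v) * p v)"
proof -
  have "(\<Sum>e\<in>A. at_terminus p e) = (\<Sum>e\<in>A. p (fst e))"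
    by (subst sum_arcs_swap) (simp add: at_terminus_def arcs_D)
  then show ?thesis by (simp add: sum_arcs_fst d_eq_card)
qed

lemma card_arcs: "card A = (\<Sum>v\<in>V. d v)"
  by (simp add: arcs_Sigma finite_V d_eq_card)

end

section \<open>Consequences of an odd power of the walk being the identity\<close>

locale odd_periodic_graph = nontrivial_connected_graph +
  fixes k :: nat
  assumes odd: "odd k" and power_id: "grover_pow_is_id V E k"
begin

lemma steps_period:
  assumes "supported g"
  shows "(step ^^ k) g = g"
proof (rule supported_ext)
  fix e assume e: "e \<in> A"
  have "(step ^^ k) g e = (\<Sum>f\<in>A. (if e = f then 1 else 0) * g f)"
    using power_id e unfolding grover_pow_is_id_def by (simp add: steps_mat_pow cong: sum.cong)
  then show "(step ^^ k) g e = g e"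
    using e by (simp add: if_distrib[of "\<lambda>x. x * _"] cong: if_cong)
qed (use assms in auto)

lemma steps_mod:
  assumes "supported g"
  shows "(step ^^ i) g = (step ^^ (i mod k)) g"
proof -
  have "(step ^^ (k * q + r)) g = (step ^^ r) g" for q r
  proof (induction q)
    case (Suc q)
    have "(step ^^ (k * Suc q + r)) g = (step ^^ k) ((step ^^ (k * q + r)) g)"
      by (simp add: funpow_add[symmetric, THEN fun_cong, simplified] add.assoc)
    then show ?case using Suc assms by (simp add: steps_period)
  qed simp
  from this[of "i div k" "i mod k"] show ?thesis by simp
qed

text \<open>An eigenvalue -1 of U would give (-1)^k = 1, impossible for odd k. Hence 1 + U is
  injective.\<close>

lemma step_neg_fixed:
  assumes "supported g" "step g = (\<lambda>e. - g e)"
  shows "g = (\<lambda>e. 0)"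
proof -
  have "(step ^^ i) g = (if even i then g else (\<lambda>e. - g e))" for i
    by (induction i) (simp_all add: step_minus assms(2))
  from this[of k] have "g e = - g e" for e
    using steps_period[OF assms(1)] odd by (metis (no_types))
  then show ?thesis by (auto simp: fun_eq_iff)
qed


text \<open>On supported functions this is k times the projection onto the fixed space of U.\<close>

definition orbit_sum :: "('a \<times> 'a \<Rightarrow> complex) \<Rightarrow> 'a \<times> 'a \<Rightarrow> complex" where
  "orbit_sum x e = (\<Sum>i<k. (step ^^ i) x e)"

lemma orbit_sum_fun: "orbit_sum x = (\<lambda>e. \<Sum>i<k. (step ^^ i) x e)"
  by (simp add: orbit_sum_def fun_eq_iff)

lemma supported_orbit_sum: "supported x \<Longrightarrow> supported (orbit_sum x)"
  using supported_steps by (auto simp: supported_def orbit_sum_def intro!: sum.neutral)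

lemma orbit_sum_step:
  assumes "supported x"
  shows "orbit_sum (step x) = orbit_sum x"
proof
  fix e
  have "(\<Sum>i<k. (step ^^ Suc i) x e) + x e = (\<Sum>i<Suc k. (step ^^ i) x e)"
    by (subst sum.lessThan_Suc_shift) simp
  also have "\<dots> = orbit_sum x e + x e"
    using assms by (simp add: orbit_sum_def steps_period)
  finally show "orbit_sum (step x) e = orbit_sum x e"
    by (simp add: orbit_sum_def funpow_swap1)
qed

lemma step_orbit_sum:
  assumes "supported x"
  shows "step (orbit_sum x) = orbit_sum x"
proof -
  have "step (orbit_sum x) = orbit_sum (step x)"
    by (simp add: orbit_sum_fun step_sum funpow_swap1)
  then show ?thesis using assms by (simp add: orbit_sum_step)
qed

lemma supported_reverse: "supported x \<Longrightarrow> supported (reverse x)"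
  using swap_arcs_iff by (auto simp: supported_def reverse_def)

lemma orbit_sum_reverse:
  assumes "supported x"
  shows "reverse (orbit_sum x) = orbit_sum (reverse x)"
proof
  fix e
  \<comment> \<open>S U^i is U^(k-i) S because U^k = 1. The exponent is written
    \<open>Suc (k - Suc i)\<close> to fit the reindexing of the sum; it runs from k down to 1, and
    the shift by one is absorbed by \<open>orbit_sum_step\<close>.\<close>
  have *: "reverse ((step ^^ i) x) = (step ^^ Suc (k - Suc i)) (reverse x)" if "i < k" for i
  proof -
    have "(step ^^ k) (reverse ((step ^^ i) x)) = (step ^^ (k - i)) ((step ^^ i) (reverse ((step ^^ i) x)))"
      using that by (simp add: funpow_add[symmetric, THEN fun_cong, simplified])
    then show ?thesis
      using assms that by (simp add: steps_period supported_reverse steps_reverse_steps Suc_diff_Suc)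
  qed
  have "reverse (orbit_sum x) e = (\<Sum>i<k. (step ^^ Suc (k - Suc i)) (reverse x) e)"
    unfolding orbit_sum_fun reverse_sum by (rule sum.cong) (simp_all add: *)
  also have "\<dots> = (\<Sum>i<k. (step ^^ Suc i) (reverse x) e)"
    by (rule sum.nat_diff_reindex)
  also have "\<dots> = orbit_sum (step (reverse x)) e"
    by (simp add: orbit_sum_def funpow_swap1)
  finally show "reverse (orbit_sum x) e = orbit_sum (reverse x) e"
    using assms by (simp add: orbit_sum_step supported_reverse)
qed

text \<open>A function fixed by the walk and by arc reversal takes on each arc the mean value over
  the arcs at its origin, so connectedness makes it constant.\<close>

lemma orbit_sum_at_terminus:
  assumes zero: "(\<Sum>v\<in>V. of_nat (d v) * p v) = 0"
  shows "orbit_sum (at_terminus p) = (\<lambda>e. 0)"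
proof -
  define h where "h = orbit_sum (at_terminus p)"
  have supp: "supported h" by (simp add: h_def supported_orbit_sum)
  have fixed: "step h = h" by (simp add: h_def step_orbit_sum)
  have sym: "h (snd e, fst e) = h e" for e
  proof -
    \<comment> \<open>Reversing a function of the terminus is the same as applying U to it, which
      does not change its orbit sum.\<close>
    have "reverse h = h"
      by (simp add: h_def orbit_sum_reverse step_at_terminus[symmetric] orbit_sum_step)
    then show ?thesis by (metis reverse_def)
  qed
  define a where "a v = (\<Sum>u\<in>nb v. h (u, v)) / of_nat (d v)" for v
  have ha: "h e = a (fst e)" if "e \<in> A" for e
  proof -
    \<comment> \<open>Both \<open>step h\<close> and the reversal of \<open>h\<close> equal
      \<open>h\<close>, so \<open>step_eq\<close> reads h = 2 a - h.\<close>
    have "2 * h e = 2 * a (fst e)"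
      using step_eq[OF that, of h] by (simp add: fixed sym a_def)
    then show ?thesis by simp
  qed
  have const: "a x = a y" if "E x y" for x y
    using ha[of "(x, y)"] ha[of "(y, x)"] sym[of "(x, y)"] that by (simp add: arcs_iff E_sym)
  obtain e0 where e0: "e0 \<in> A" using arcs_nonempty by blast
  have a: "a v = a (fst e0)" if "v \<in> V" for v
    by (rule vertex_induct[of "fst e0" v]) (use that e0 arcs_D const in auto)
  \<comment> \<open>By now \<open>h\<close> is constant on arcs; its total vanishes since U
    preserves totals and the degree-weighted sum of \<open>p\<close> is 0.\<close>
  have "(\<Sum>e\<in>A. h e) = (\<Sum>i<k. \<Sum>e\<in>A. (step ^^ i) (at_terminus p) e)"
    unfolding h_def orbit_sum_def by (rule sum.swap)
  also have "\<dots> = 0" using zero by (simp add: sum_steps sum_at_terminus)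
  finally have "of_nat (card A) * a (fst e0) = 0"
    using ha a arcs_D by simp
  then have "a (fst e0) = 0" using arcs_nonempty by simp
  then have "h e = 0" for e
    using ha[of e] a[of "fst e"] arcs_D(1)[of e] supp unfolding supported_def by fastforce
  then show ?thesis by (simp add: h_def fun_eq_iff)
qed

text \<open>Since \<open>1 - (1 + X + \<dots> + X\<^bsup>k-1\<^esup>) = - (1 + X) (X + X\<^sup>3 + \<dots> + X\<^bsup>k-2\<^esup>)\<close>, this is an
  integral inverse of \<open>1 + step\<close> on the kernel of \<open>orbit_sum\<close>.\<close>

definition half_inverse :: "('a \<times> 'a \<Rightarrow> complex) \<Rightarrow> 'a \<times> 'a \<Rightarrow> complex" where
  "half_inverse x e = - (\<Sum>i<k div 2. (step ^^ Suc (2 * i)) x e)"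

lemma half_inverse_fun: "half_inverse x = (\<lambda>e. - (\<Sum>i<k div 2. (step ^^ Suc (2 * i)) x e))"
  by (simp add: half_inverse_def fun_eq_iff)

lemma half_inverse_eq: "half_inverse (\<lambda>e. x e + step x e) e = x e - orbit_sum x e"
proof -
  \<comment> \<open>Consecutive odd and even exponents pair up to 1, ..., 2m. For m =
    \<open>k div 2\<close> the exponent 0 completes them to the full orbit, as k is odd.\<close>
  have *: "(\<Sum>i<m. (step ^^ Suc (2 * i)) x e + (step ^^ Suc (Suc (2 * i))) x e)
      = (\<Sum>i<2 * m. (step ^^ Suc i) x e)" for m
    by (induction m) auto
  have "half_inverse (\<lambda>e. x e + step x e) e
      = - (\<Sum>i<k div 2. (step ^^ Suc (2 * i)) x e + (step ^^ Suc (Suc (2 * i))) x e)"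
    by (simp only: half_inverse_def steps_add) (simp add: funpow_swap1)
  also have "\<dots> = x e - (\<Sum>i<Suc (2 * (k div 2)). (step ^^ i) x e)"
    by (subst sum.lessThan_Suc_shift, subst *) simp
  finally show ?thesis using odd by (simp add: orbit_sum_def)
qed

lemma at_terminus_cong: "(\<And>v. v \<in> V \<Longrightarrow> p v = q v) \<Longrightarrow> at_terminus p = at_terminus q"
  by (auto simp: at_terminus_def fun_eq_iff arcs_V)

text \<open>The equation becomes (1 + U)^2 x = U y for the corresponding terminus functions x and y.
  Both x and (1 + U) x have orbit sum 0, so \<open>half_inverse\<close> cancels one factor at a
  time.\<close>

lemma signless_solution:
  assumes zero: "(\<Sum>v\<in>V. of_nat (d v) * q v) = 0"
    and eq: "\<And>v. v \<in> V \<Longrightarrow> signless q v = p v"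
  shows "at_terminus q = half_inverse (half_inverse (step (at_terminus p)))"
proof -
  let ?x = "at_terminus q"
  let ?y = "\<lambda>e. ?x e + step ?x e"
  have J: "orbit_sum ?x = (\<lambda>e. 0)" by (rule orbit_sum_at_terminus[OF zero])
  have Jy: "orbit_sum ?y = (\<lambda>e. 0)"
  proof -
    have "orbit_sum ?y e = orbit_sum ?x e + orbit_sum (step ?x) e" for e
      by (simp add: orbit_sum_def steps_add sum.distrib)
    then show ?thesis by (simp add: orbit_sum_step J fun_eq_iff)
  qed
  have "at_terminus (signless q) = at_terminus p"
    by (rule at_terminus_cong) (rule eq)
  then have "step (at_terminus p) e = ?y e + step ?y e" for e
    using signless_step[of q e] by (simp add: step_add algebra_simps)
  then have y: "step (at_terminus p) = (\<lambda>e. ?y e + step ?y e)" ..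
  have "half_inverse (step (at_terminus p)) = ?y"
    by (rule ext) (simp only: y half_inverse_eq Jy diff_zero)
  then show ?thesis
    by (intro ext) (simp only: half_inverse_eq J diff_zero)
qed

text \<open>A kernel element gives (1 + U)^2 x = 0, and each factor is injective because -1 is not
  an eigenvalue of U.\<close>

lemma signless_inj:
  assumes "\<And>v. v \<in> V \<Longrightarrow> signless p v = 0" "v \<in> V"
  shows "p v = 0"
proof -
  let ?x = "at_terminus p"
  let ?y = "\<lambda>e. ?x e + step ?x e"
  have "at_terminus (signless p) = (\<lambda>e. 0)"
    using assms(1) by (auto simp: at_terminus_def fun_eq_iff arcs_V)
  then have "?y e + step ?y e = 0" for e
    using signless_step[of p e] by (simp add: step_add step_zero algebra_simps)
  then have "step ?y = (\<lambda>e. - ?y e)"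
    by (auto simp: fun_eq_iff add_eq_0_iff)
  moreover have "supported ?y"
    using supported_at_terminus[of p] supported_step[of ?x] unfolding supported_def by auto
  ultimately have y: "?y = (\<lambda>e. 0)" by (rule step_neg_fixed[rotated])
  then have "step ?x e = - ?x e" for e
    by (metis (no_types, lifting) add_eq_0_iff)
  then have "step ?x = (\<lambda>e. - ?x e)" by blast
  then have x: "?x = (\<lambda>e. 0)" by (rule step_neg_fixed[rotated]) simp
  obtain u where "(u, v) \<in> A" using arc_into[OF assms(2)] .
  then show ?thesis using fun_cong[OF x, of "(u, v)"] by (simp add: at_terminus_def)
qed

text \<open>N is a common denominator for the whole orbit of x. Including all iterates makes the
  property stable under U and so under integral polynomials in U such as
  \<open>half_inverse\<close>.\<close>

definition lattice :: "complex \<Rightarrow> ('a \<times> 'a \<Rightarrow> complex) \<Rightarrow> bool" where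
  "lattice N x \<longleftrightarrow> (\<forall>i e. N * (step ^^ i) x e \<in> \<int>)"

lemma lattice_step: "lattice N x \<Longrightarrow> lattice N (step x)"
  unfolding lattice_def by (metis funpow_simps_right(2) o_apply)

lemma lattice_steps: "lattice N x \<Longrightarrow> lattice N ((step ^^ i) x)"
  by (induction i) (auto simp: lattice_step)

lemma lattice_half_inverse:
  assumes "lattice N x"
  shows "lattice N (half_inverse x)"
proof -
  have "N * (step ^^ j) ((step ^^ Suc (2 * i)) x) e \<in> \<int>" for i j e
    using lattice_steps[OF assms] by (simp only: lattice_def)
  then show ?thesis
    unfolding lattice_def half_inverse_fun
    by (simp only: steps_minus steps_sum finite_lessThan mult_minus_right sum_distrib_left Ints_minus Ints_sum simp_thms)
qed

text \<open>Inverting 2 + 2P on functions of weighted sum 0 does not enlarge the denominator, so the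
  inverse can be iterated with N fixed.\<close>

lemma lattice_signless:
  assumes "lattice N (at_terminus p)" "(\<Sum>v\<in>V. of_nat (d v) * q v) = 0"
    and "\<And>v. v \<in> V \<Longrightarrow> signless q v = p v"
  shows "lattice N (at_terminus q)"
  using signless_solution[OF assms(2,3)] assms(1)
  by (simp add: lattice_half_inverse lattice_step)

lemma lattice_vertex:
  assumes "lattice N (at_terminus p)" "v \<in> V"
  shows "N * p v \<in> \<int>"
proof -
  obtain u where "(u, v) \<in> A" using arc_into[OF assms(2)] .
  moreover have "N * (step ^^ 0) (at_terminus p) (u, v) \<in> \<int>"
    using assms(1) unfolding lattice_def by blast
  ultimately show ?thesis by (simp add: at_terminus_def)
qed

lemma mat_pow_rational: "mat_pow_on A (grover V E) i e f \<in> \<rat>"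
  by (induction i arbitrary: e) (auto simp: grover_def intro!: Rats_sum Rats_mult Rats_divide Rats_diff)

text \<open>The powers of U have rational entries and, by periodicity, only finitely many occur; N
  is a common denominator of all their entries, independent of c and p.\<close>

lemma lattice_exists:
  obtains N :: nat where "N > 0"
    "\<And>c p. (\<And>v. v \<in> V \<Longrightarrow> of_nat c * p v \<in> \<int>) \<Longrightarrow> lattice (of_nat (N * c)) (at_terminus p)"
proof -
  let ?P = "mat_pow_on A (grover V E)"
  let ?S = "(\<lambda>(i, e, f). ?P i e f) ` ({..<k} \<times> A \<times> A)"
  have "\<exists>N>0. \<forall>x\<in>S. of_nat N * x \<in> \<int>" if "finite S" "S \<subseteq> \<rat>" for S :: "complex set"
    using that
  proof (induction rule: finite_induct)
    case (insert x S)
    then obtain N where N: "N > 0" "\<forall>x\<in>S. of_nat N * x \<in> \<int>" by auto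
    obtain a b where ab: "b > 0" "x = of_int a / of_int b"
      using insert.prems by (metis Rats_cases' insert_subset)
    have "of_nat (N * nat b) * y \<in> \<int>" if "y \<in> insert x S" for y
    proof (cases "y = x")
      case True
      then have "of_nat (N * nat b) * y = of_int (int N * a)" using ab by simp
      then show ?thesis by (metis Ints_of_int)
    next
      case False
      then have "of_nat N * y \<in> \<int>" using that N(2) by blast
      then have "of_int b * (of_nat N * y) \<in> \<int>" by (rule Ints_mult[OF Ints_of_int])
      then show ?thesis using ab by (simp add: mult_ac)
    qed
    then show ?case using N(1) ab(1) by (intro exI[of _ "N * nat b"]) auto
  qed (auto intro: exI[of _ "1::nat"])
  moreover have "finite ?S" "?S \<subseteq> \<rat>"
    using mat_pow_rational by auto
  ultimately obtain N where N: "N > 0" "\<And>x. x \<in> ?S \<Longrightarrow> of_nat N * x \<in> \<int>"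
    by meson
  have "lattice (of_nat (N * c)) (at_terminus p)" if p: "\<And>v. v \<in> V \<Longrightarrow> of_nat c * p v \<in> \<int>" for c p
    unfolding lattice_def
  proof (intro allI)
    fix i e
    let ?i = "i mod k"
    have "?i < k" using odd by (simp add: odd_pos)
    then have *: "of_nat N * ?P ?i e f \<in> \<int>" if "e \<in> A" "f \<in> A" for f
      using that by (intro N(2)) force
    show "of_nat (N * c) * (step ^^ i) (at_terminus p) e \<in> \<int>"
    proof (cases "e \<in> A")
      case True
      then have "of_nat (N * c) * (step ^^ i) (at_terminus p) e
          = (\<Sum>f\<in>A. (of_nat N * ?P ?i e f) * (of_nat c * p (snd f)))"
        by (simp add: steps_mod[of _ i] steps_mat_pow sum_distrib_left at_terminus_def mult_ac)
      moreover have "(of_nat N * ?P ?i e f) * (of_nat c * p (snd f)) \<in> \<int>" if "f \<in> A" for f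
        by (rule Ints_mult[OF *[OF True that] p[OF arcs_D(2)[OF that]]])
      ultimately show ?thesis by (simp only: Ints_sum)
    next
      case False
      then have "(step ^^ i) (at_terminus p) e = 0"
        using supported_steps[OF supported_at_terminus] unfolding supported_def by blast
      then show ?thesis by simp
    qed
  qed
  then show ?thesis using that N(1) by blast
qed

text \<open>As \<open>step\<close> is the \<open>(k + 1)\<close>-st power, \<open>step \<circ> reverse\<close> is a conjugate of \<open>reverse\<close>, so that both
  have trace \<open>0\<close>.\<close>

lemma card_arcs_eq: "card A = 2 * card V"
proof -
  define \<delta> :: "'a \<times> 'a \<Rightarrow> 'a \<times> 'a \<Rightarrow> complex" where "\<delta> f e = (if e = f then 1 else 0)" for f e
  \<comment> \<open>With i = (k + 1) / 2, the power U^i is a square root of U.\<close>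
  define i where "i = Suc k div 2"
  have i: "i + i = Suc k" using odd by (auto simp: i_def elim: oddE)
  let ?P = "mat_pow_on A (grover V E) i"
  have supp: "supported (\<delta> f)" if "f \<in> A" for f using that by (auto simp: supported_def \<delta>_def)
  have P: "(step ^^ i) (\<delta> f) e = ?P e f" if "e \<in> A" "f \<in> A" for e f
    using that by (simp add: steps_mat_pow \<delta>_def if_distrib[of "\<lambda>x. _ * x"] cong: if_cong)
  have U: "step (\<delta> f) e = (\<Sum>g\<in>A. ?P e g * ?P g f)" if "e \<in> A" "f \<in> A" for e f
  proof -
    have "step (\<delta> f) = (step ^^ (i + i)) (\<delta> f)"
      using steps_period[OF supp[OF that(2)]] by (simp add: i)
    then show ?thesis using that by (simp add: funpow_add steps_mat_pow[of e i] P)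
  qed
  \<comment> \<open>The trace of U S is rearranged cyclically into that of U^i S U^i = S, which is 0
    as no arc is its own reverse.\<close>
  have "(\<Sum>e\<in>A. step (\<delta> (snd e, fst e)) e) = (\<Sum>e\<in>A. \<Sum>g\<in>A. ?P e g * ?P g (snd e, fst e))"
    using arcs_D by (simp add: U)
  also have "\<dots> = (\<Sum>g\<in>A. \<Sum>e\<in>A. ?P e g * ?P g (snd e, fst e))"
    by (rule sum.swap)
  also have "\<dots> = (\<Sum>g\<in>A. \<Sum>e\<in>A. ?P g e * ?P (snd e, fst e) g)"
    by (subst (2) sum_arcs_swap) (simp add: mult.commute)
  also have "\<dots> = (\<Sum>g\<in>A. (step ^^ i) (reverse ((step ^^ i) (\<delta> g))) g)"
    using arcs_D by (simp add: steps_mat_pow[of _ i "reverse _"] reverse_def P)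
  also have "\<dots> = (\<Sum>g\<in>A. 0)"
    using no_loop by (intro sum.cong) (auto simp: steps_reverse_steps supp reverse_def \<delta>_def)
  finally have tr: "(\<Sum>e\<in>A. step (\<delta> (snd e, fst e)) e) = 0" by simp
  \<comment> \<open>The same trace read off the diagonal is 2 |V| - |A|, since each vertex v is the
    origin of deg v arcs.\<close>
  have "(\<Sum>e\<in>A. step (\<delta> (snd e, fst e)) e) = (\<Sum>e\<in>A. 2 / of_nat (d (fst e)) - 1)"
  proof (rule sum.cong)
    fix e assume e: "e \<in> A"
    then show "step (\<delta> (snd e, fst e)) e = 2 / of_nat (d (fst e)) - 1"
      using arcs_D[OF e] by (simp add: step_eq \<delta>_def)
  qed simp
  also have "\<dots> = (\<Sum>v\<in>V. of_nat (d v) * (2 / of_nat (d v))) - of_nat (card A)"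
    by (simp add: sum_subtractf sum_arcs_fst d_eq_card)
  also have "(\<Sum>v\<in>V. of_nat (d v) * (2 / of_nat (d v))) = (\<Sum>v\<in>V. (2::complex))"
    using d_pos by (intro sum.cong) auto
  finally have "of_nat (card A) = (of_nat (2 * card V) :: complex)" using tr by (simp add: mult.commute)
  then show ?thesis by (simp only: of_nat_eq_iff)
qed

end

section \<open>Cycle graphs\<close>

context nontrivial_connected_graph
begin

text \<open>For degree 2 the reflection coefficient 2/2 - 1 vanishes and the transmission
  coefficient is 1: U moves a unit mass from an arc to its non-backtracking successor.\<close>

lemma mat_pow_Suc_2_regular:
  assumes "\<And>v. v \<in> V \<Longrightarrow> d v = 2" "(y, z) \<in> A" "(x, y) \<in> A" "x \<noteq> z"
    and g: "\<And>e. e \<in> A \<Longrightarrow> mat_pow_on A (grover V E) n e f = (if e = (x, y) then 1 else 0)"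
    and e: "e \<in> A"
  shows "mat_pow_on A (grover V E) (Suc n) e f = (if e = (y, z) then 1 else 0)"
proof -
  have "mat_pow_on A (grover V E) (Suc n) e f = (\<Sum>h\<in>A. grover V E e h * (if h = (x, y) then 1 else 0))"
    by (simp add: g)
  also have "\<dots> = grover V E e (x, y)"
    using assms(3) by (simp add: if_distrib[of "\<lambda>x. _ * x"] cong: if_cong)
  also have "\<dots> = (if e = (y, z) then 1 else 0)"
  proof -
    have y: "y \<in> V" using arcs_V assms by blast
    have "z \<in> nb y" "x \<in> nb y" using assms by (auto simp: arcs_iff in_nb E_sym)
    moreover have "card (nb y) = 2" using assms(1)[OF y] by (simp add: d_eq_card)
    ultimately have "nb y = {x, z}"
      using assms(4) by (intro card_subset_eq[symmetric]) auto
    then have "e = (y, x) \<or> e = (y, z)" if "fst e = y"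
      using arcs_D(3)[OF e] that by (cases e) auto
    moreover have "d y = 2" using assms(1)[OF y] .
    ultimately show ?thesis
      using e assms(3,4) by (cases e; cases "fst e = y") (auto simp: grover_arcs)
  qed
  finally show ?thesis .
qed

end

text \<open>U rotates the arcs of either orientation by one place, so its powers are the identity
  exactly at the multiples of n.\<close>

lemma cycle_graph_period:
  assumes G: "simple_graph V E" "connected_graph V E" and n: "n \<ge> 3" and cyc: "is_cycle_graph V E n"
  shows "k_periodic V E n"
proof -
  obtain \<phi> where bij: "bij_betw \<phi> {0..<n} V"
    and adj: "\<And>i j. i < n \<Longrightarrow> j < n \<Longrightarrow> E (\<phi> i) (\<phi> j) \<longleftrightarrow> (j = (i + 1) mod n \<or> i = (j + 1) mod n)"
    using cyc unfolding is_cycle_graph_def by blast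
  \<comment> \<open>Indexing by all integers, with period n, turns both directions around the cycle
    into adding s = 1 or s = -1 without wrap-around cases.\<close>
  define \<psi> :: "int \<Rightarrow> 'a" where "\<psi> i = \<phi> (nat (i mod int n))" for i
  have lt: "nat (i mod int n) < n" for i using n by (simp add: nat_less_iff)
  have \<psi>_eq: "\<psi> i = \<psi> j \<longleftrightarrow> i mod int n = j mod int n" for i j
  proof -
    have "\<psi> i = \<psi> j \<longleftrightarrow> nat (i mod int n) = nat (j mod int n)"
      unfolding \<psi>_def using bij lt by (auto simp: bij_betw_def dest!: inj_onD)
    then show ?thesis using n by (simp add: eq_nat_nat_iff)
  qed
  have \<psi>_cong: "\<psi> i = \<psi> j \<longleftrightarrow> int n dvd i - j" for i j
    by (simp add: \<psi>_eq mod_eq_dvd_iff)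
  have succ: "nat (j mod int n) = (nat (i mod int n) + 1) mod n \<longleftrightarrow> int n dvd j - (i + 1)" for i j
  proof -
    have "nat (j mod int n) = (nat (i mod int n) + 1) mod n \<longleftrightarrow>
        int (nat (j mod int n)) = int ((nat (i mod int n) + 1) mod n)"
      by (rule of_nat_eq_iff[symmetric])
    also have "\<dots> \<longleftrightarrow> j mod int n = (i + 1) mod int n"
      using n by (simp add: zmod_int mod_simps add.commute)
    finally show ?thesis by (simp add: mod_eq_dvd_iff)
  qed
  have E_\<psi>: "E (\<psi> i) (\<psi> j) \<longleftrightarrow> int n dvd j - (i + 1) \<or> int n dvd i - (j + 1)" for i j
    unfolding \<psi>_def adj[OF lt lt] succ ..
  have onto: "\<exists>i. v = \<psi> i" if v: "v \<in> V" for v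
  proof -
    obtain j where "j < n" "v = \<phi> j" using bij v by (auto simp: bij_betw_def)
    then have "v = \<psi> (int j)" by (simp add: \<psi>_def)
    then show ?thesis ..
  qed
  \<comment> \<open>This is where n is at least 3: the two neighbours of a vertex are
    distinct.\<close>
  have two: "\<not> int n dvd 2" "\<not> int n dvd - 2"
    using n by (auto dest!: zdvd_imp_le)
  have "E (\<psi> 0) (\<psi> 1)" by (simp add: E_\<psi>)
  moreover from this have "\<psi> 0 \<in> V" "\<psi> 1 \<in> V"
    using G by (auto simp: simple_graph_def)
  ultimately interpret nontrivial_connected_graph V E
    using G by unfold_locales (auto simp: arcs_def)
  have nb: "nb (\<psi> i) = {\<psi> (i + 1), \<psi> (i - 1)}" for i
  proof (intro equalityI subsetI)
    fix v assume "v \<in> nb (\<psi> i)"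
    then obtain j where "v = \<psi> j" "E (\<psi> i) (\<psi> j)"
      using onto in_nb E_V by blast
    then have "v = \<psi> j" "int n dvd j - (i + 1) \<or> int n dvd j - (i - 1)"
      using dvd_diff_commute[of "int n" i "j + 1"] by (auto simp: E_\<psi> algebra_simps)
    then show "v \<in> {\<psi> (i + 1), \<psi> (i - 1)}" by (auto simp: \<psi>_cong)
  qed (auto simp: in_nb E_\<psi>)
  have d2: "d v = 2" if "v \<in> V" for v
  proof -
    obtain i where v: "v = \<psi> i" using onto[OF \<open>v \<in> V\<close>] by blast
    have "\<psi> (i + 1) \<noteq> \<psi> (i - 1)" using two by (simp add: \<psi>_cong)
    then show ?thesis by (simp add: d_eq_card v nb)
  qed
  have pow: "mat_pow_on A (grover V E) m e (\<psi> i, \<psi> (i + s)) =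
      (if e = (\<psi> (i + int m * s), \<psi> (i + int m * s + s)) then 1 else 0)"
    if "s = 1 \<or> s = -1" "e \<in> A" for m e i s
    using that(2)
  proof (induction m arbitrary: e)
    case (Suc m)
    let ?j = "i + int m * s"
    have j: "i + int (Suc m) * s = ?j + s" by (simp add: algebra_simps)
    show ?case unfolding j
    proof (rule mat_pow_Suc_2_regular[OF d2 _ _ _ Suc.IH Suc.prems])
      show "(\<psi> (?j + s), \<psi> (?j + s + s)) \<in> A" "(\<psi> ?j, \<psi> (?j + s)) \<in> A"
        using that(1) by (auto simp: arcs_iff E_\<psi>)
      show "\<psi> ?j \<noteq> \<psi> (?j + s + s)"
        using that(1) two by (auto simp: \<psi>_cong)
    qed auto
  qed auto
  have id: "grover_pow_is_id V E m \<longleftrightarrow> n dvd m" for m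
  proof
    assume "grover_pow_is_id V E m"
    moreover have "(\<psi> 0, \<psi> (0 + 1)) \<in> A" by (simp add: arcs_iff E_\<psi>)
    ultimately have "mat_pow_on A (grover V E) m (\<psi> 0, \<psi> (0 + 1)) (\<psi> 0, \<psi> (0 + 1)) = 1"
      unfolding grover_pow_is_id_def by simp
    then have "\<psi> 0 = \<psi> (int m)"
      using \<open>(\<psi> 0, \<psi> (0 + 1)) \<in> A\<close> by (subst (asm) pow) (auto split: if_splits)
    then show "n dvd m" by (simp add: \<psi>_cong)
  next
    assume m: "n dvd m"
    have *: "\<psi> (i + int m * s) = \<psi> i" for i s
      using m by (simp add: \<psi>_cong)
    show "grover_pow_is_id V E m"
      unfolding grover_pow_is_id_def
    proof (intro ballI)
      fix e f assume e: "e \<in> A" and f: "f \<in> A"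
      obtain i where i: "fst f = \<psi> i" using onto arcs_D(1)[OF f] by blast
      then have "snd f = \<psi> (i + 1) \<or> snd f = \<psi> (i + (-1))"
        using arcs_D(3)[OF f] nb by simp
      then obtain s :: int where s: "s = 1 \<or> s = -1" "f = (\<psi> i, \<psi> (i + s))"
        using i by (metis prod.collapse)
      have "\<psi> (i + int m * s + s) = \<psi> (i + s)"
        using *[of "i + s" s] by (simp add: algebra_simps)
      then show "mat_pow_on A (grover V E) m e f = (if e = f then 1 else 0)"
        using pow[OF s(1) e, of m i] by (simp add: s(2) *)
    qed
  qed
  have "period V E = n"
    unfolding period_def id using n by (intro Least_equality) (auto intro: dvd_imp_le)
  moreover have "periodic V E"
    unfolding periodic_def id using n by (intro exI[of _ n]) auto
  ultimately show ?thesis by (simp add: k_periodic_def)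
qed

context nontrivial_connected_graph
begin

text \<open>The cycle is found as a non-backtracking walk up to its first repeated vertex.\<close>

lemma two_regular_cycle_graph:
  assumes d2: "\<And>v. v \<in> V \<Longrightarrow> d v = 2"
  obtains n where "n \<ge> 3" "is_cycle_graph V E n"
proof -
  have nbs: "\<exists>z. z \<noteq> x \<and> nb y = {x, z}" if "E x y" for x y
  proof -
    have "card (nb y) = 2" "x \<in> nb y"
      using d2 that E_V by (auto simp: d_eq_card in_nb E_sym)
    then show ?thesis by (auto simp: card_2_iff)
  qed
  obtain x0 y0 where "(x0, y0) \<in> A" using arcs_nonempty by auto
  then have xy: "E x0 y0" by (simp add: arcs_iff)
  define next_arc where "next_arc = (\<lambda>(x, y). (y, SOME z. z \<noteq> x \<and> nb y = {x, z}))"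
  define w where "w i = fst ((next_arc ^^ i) (x0, y0))" for i
  have pair: "(next_arc ^^ i) (x0, y0) = (w i, w (Suc i))" for i
    by (auto simp: w_def next_arc_def split: prod.splits)
  have next_eq: "w (Suc (Suc i)) = (SOME z. z \<noteq> w i \<and> nb (w (Suc i)) = {w i, z})" for i
  proof -
    have "(next_arc ^^ Suc i) (x0, y0) = next_arc (w i, w (Suc i))" by (simp add: pair)
    then have "snd ((next_arc ^^ Suc i) (x0, y0)) = (SOME z. z \<noteq> w i \<and> nb (w (Suc i)) = {w i, z})"
      by (simp add: next_arc_def)
    then show ?thesis by (simp only: pair snd_conv)
  qed
  have w_nb': "w (Suc (Suc i)) \<noteq> w i \<and> nb (w (Suc i)) = {w i, w (Suc (Suc i))}" if "E (w i) (w (Suc i))" for i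
    unfolding next_eq by (rule someI_ex[OF nbs[OF that]])
  have w_E: "E (w i) (w (Suc i))" for i
  proof (induction i)
    case 0
    then show ?case using pair[of 0] xy by simp
  next
    case (Suc i)
    then show ?case using w_nb'[OF Suc] in_nb by blast
  qed
  have w_ne: "w (Suc (Suc i)) \<noteq> w i" and w_nb: "nb (w (Suc i)) = {w i, w (Suc (Suc i))}" for i
    using w_nb'[OF w_E] by auto
  have "\<not> inj w"
  proof
    assume "inj w"
    moreover have "range w \<subseteq> V" using w_E E_V by blast
    ultimately show False using finite_V finite_imageD finite_subset by blast
  qed
  then have ex: "\<exists>j. \<exists>i<j. w i = w j"
    unfolding inj_def by (metis linorder_neqE_nat)
  define n where "n = (LEAST j. \<exists>i<j. w i = w j)"
  obtain i where i: "i < n" "w i = w n" using LeastI_ex[OF ex] unfolding n_def by blast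
  have inj: "w a \<noteq> w b" if "a < b" "b < n" for a b
    using not_less_Least[of b "\<lambda>j. \<exists>i<j. w i = w j"] that unfolding n_def by blast
  have inj_eq: "w a = w b \<longleftrightarrow> a = b" if "a < n" "b < n" for a b
    using inj that by (metis linorder_neqE_nat)
  obtain n1 where n1: "n = Suc n1" using i by (cases n) auto
  \<comment> \<open>The first repetition closes up at the start: otherwise \<open>w n1\<close> would
    be a neighbour of \<open>w i\<close>, hence one of its two neighbours on the walk, which
    contradicts minimality of n, non-backtracking or the absence of loops.\<close>
  have i0: "i = 0"
  proof (rule ccontr)
    assume "i \<noteq> 0"
    then obtain j where j: "i = Suc j" by (cases i) auto
    have "E (w i) (w n1)" using w_E[of n1] i by (simp add: n1 E_sym)
    then have "w n1 = w j \<or> w n1 = w (Suc (Suc j))" using w_nb[of j] in_nb j by auto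
    then show False
    proof
      assume "w n1 = w j"
      then show False using inj_eq[of n1 j] i j by (simp add: n1)
    next
      assume *: "w n1 = w (Suc (Suc j))"
      show False
      proof (cases "Suc (Suc j) < n")
        case True
        then have "n1 = Suc (Suc j)" using * inj_eq[of n1 "Suc (Suc j)"] by (simp add: n1)
        then show False using w_ne[of i] i j by (simp add: n1)
      next
        case False
        then have "n = Suc i" using i j by simp
        then show False using i w_E[of i] E_irrefl by metis
      qed
    qed
  qed
  have n3: "n \<ge> 3"
  proof (rule ccontr)
    assume "\<not> n \<ge> 3"
    then have "n = 1 \<or> n = 2" using i by auto
    then show False using i i0 w_E[of 0] w_ne[of 0] E_irrefl by (auto simp: numeral_2_eq_2)
  qed
  have nb0: "nb (w 0) = {w 1, w n1}"
  proof -
    have "w n1 \<in> nb (w 0)" "w 1 \<in> nb (w 0)"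
      using w_E[of n1] w_E[of 0] i i0 by (auto simp: in_nb n1 E_sym)
    moreover have "card (nb (w 0)) = 2" using d2 w_E[of 0] E_V by (simp add: d_eq_card)
    moreover have "w 1 \<noteq> w n1" using n3 by (simp add: inj_eq n1)
    ultimately show ?thesis by (intro card_subset_eq[symmetric]) auto
  qed
  \<comment> \<open>As \<open>n1\<close> is n - 1, adding it modulo n steps one place back.\<close>
  have nbw: "nb (w a) = {w ((a + 1) mod n), w ((a + n1) mod n)}" if "a < n" for a
  proof (cases a)
    case 0
    then show ?thesis using n3 nb0 by (simp add: n1)
  next
    case (Suc b)
    have "w (Suc a) = w ((a + 1) mod n)"
      using that i i0 by (cases "Suc a = n") auto
    moreover have "(a + n1) mod n = b"
    proof -
      have "a + n1 = b + n" by (simp add: Suc n1)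
      then show ?thesis using that Suc by (simp only: mod_add_self2) simp
    qed
    ultimately show ?thesis using w_nb[of b] Suc by auto
  qed
  have img: "v \<in> w ` {0..<n}" if "v \<in> V" for v
  proof (rule vertex_induct[of "w 0" v])
    show "w 0 \<in> V" using w_E E_V by blast
    show "w 0 \<in> w ` {0..<n}" using n3 by simp
    fix x y assume "E x y" "x \<in> w ` {0..<n}"
    then obtain a where a: "a < n" "y \<in> nb (w a)" by (auto simp: in_nb)
    then show "y \<in> w ` {0..<n}" using nbw[OF a(1)] n3 by auto
  qed fact
  have "bij_betw w {0..<n} V"
    unfolding bij_betw_def inj_on_def using img inj_eq E_V(1)[OF w_E] by auto
  moreover have "E (w a) (w b) \<longleftrightarrow> (b = (a + 1) mod n \<or> a = (b + 1) mod n)" if ab: "a < n" "b < n" for a b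
  proof -
    have "E (w a) (w b) \<longleftrightarrow> b = (a + 1) mod n \<or> b = (a + n1) mod n"
      using nbw[OF ab(1)] ab by (auto simp: inj_eq simp flip: in_nb)
    also have "b = (a + n1) mod n \<longleftrightarrow> a = (b + 1) mod n"
    proof -
      have "(a + n1) mod n = (if a = 0 then n1 else a - 1)"
        using ab by (auto simp: n1 mod_if)
      moreover have "(b + 1) mod n = (if b = n1 then 0 else b + 1)"
        using ab by (auto simp: n1)
      ultimately show ?thesis using ab n3 by (auto simp: n1)
    qed
    finally show ?thesis .
  qed
  ultimately have "is_cycle_graph V E n" unfolding is_cycle_graph_def by blast
  then show ?thesis using that n3 by blast
qed

end

section \<open>The determinant bound\<close>

context nontrivial_connected_graph
begin

definition edges :: "'a set set" where "edges = (\<lambda>(u, v). {u, v}) ` A"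

lemma finite_edges: "finite edges"
  by (simp add: edges_def)

lemma card_arcs_edges: "card A = 2 * card edges"
proof -
  let ?f = "\<lambda>(u, v). {u, v} :: 'a set"
  have "card {a \<in> A. ?f a = y} = 2" if y: "y \<in> edges" for y
  proof -
    obtain u v where uv: "(u, v) \<in> A" "y = {u, v}" using y by (auto simp: edges_def)
    then have "{a \<in> A. ?f a = y} = {(u, v), (v, u)}"
      using swap_arcs_iff by (auto simp: doubleton_eq_iff)
    moreover have "u \<noteq> v" using uv no_loop by auto
    ultimately show ?thesis by simp
  qed
  then have "(\<Sum>y\<in>edges. \<Sum>a\<in>{a \<in> A. ?f a = y}. 1) = 2 * card edges" by simp
  moreover have "(\<Sum>a\<in>A. 1) = (\<Sum>y\<in>edges. \<Sum>a\<in>{a \<in> A. ?f a = y}. (1::nat))"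
    unfolding edges_def by (rule sum.image_gen) simp
  ultimately show ?thesis by simp
qed

text \<open>These counts are the entries of the incidence matrix times its transpose: degree matrix
  plus adjacency matrix.\<close>

lemma card_edges_containing:
  "card {y \<in> edges. u \<in> y \<and> v \<in> y} = (if u = v then d u else if E u v then 1 else 0)"
proof (cases "u = v")
  case True
  have "{y \<in> edges. u \<in> y \<and> v \<in> y} = (\<lambda>x. {u, x}) ` nb u"
    using True swap_arcs_iff by (auto simp: edges_def in_nb arcs_iff[symmetric] insert_commute)
  moreover have "inj_on (\<lambda>x. {u, x}) (nb u)"
    by (auto simp: inj_on_def doubleton_eq_iff)
  ultimately show ?thesis using True by (simp add: card_image d_eq_card)
next
  case False
  have "{y \<in> edges. u \<in> y \<and> v \<in> y} = (if E u v then {{u, v}} else {})"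
    using False E_sym by (auto simp: edges_def arcs_iff intro!: image_eqI)
  then show ?thesis using False by simp
qed

lemma edge_vertices: assumes "y \<in> edges" shows "card y = 2" "y \<subseteq> V"
proof -
  obtain u v where "(u, v) \<in> A" "y = {u, v}" using assms by (auto simp: edges_def)
  then show "card y = 2" "y \<subseteq> V" using no_loop[of u] arcs_V by (cases "u = v"; simp)+
qed

text \<open>Every column of the incidence matrix has sum \<open>2\<close>, which makes its determinant even.\<close>

lemma signless_det:
  assumes \<beta>: "bij_betw \<beta> {0..<card V} V" and sq: "card A = 2 * card V"
  obtains c :: int where
    "det (mat (card V) (card V) (\<lambda>(i, j). (if i = j then 2 else 0) + (if E (\<beta> i) (\<beta> j) then 2 / of_nat (d (\<beta> i)) else 0)))
      = (\<Prod>v\<in>V. 2 / of_nat (d v)) * (2 * of_int c :: complex)\<^sup>2"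
proof -
  let ?n = "card V"
  define M :: "complex mat" where
    "M = mat ?n ?n (\<lambda>(i, j). (if i = j then 2 else 0) + (if E (\<beta> i) (\<beta> j) then 2 / of_nat (d (\<beta> i)) else 0))"
  have \<beta>V: "\<beta> i \<in> V" if "i < ?n" for i using bij_betwE[OF \<beta>] that by simp
  have \<beta>_eq: "\<beta> i = \<beta> j \<longleftrightarrow> i = j" if "i < ?n" "j < ?n" for i j
    using \<beta> that by (auto simp: bij_betw_def dest: inj_onD)
  have n: "?n > 0" using arcs_nonempty arcs_V finite_V by (auto simp: card_gt_0_iff)
  \<comment> \<open>Equal numbers of edges and vertices make the incidence matrix \<open>B\<close>
    square.\<close>
  have "card edges = ?n" using card_arcs_edges sq by simp
  then obtain \<gamma> where \<gamma>: "bij_betw \<gamma> {0..<?n} edges"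
    using ex_bij_betw_nat_finite[OF finite_edges] by auto
  define B :: "int mat" where "B = mat ?n ?n (\<lambda>(i, j). if \<beta> i \<in> \<gamma> j then 1 else 0)"
  define R :: "int mat" where "R = mat ?n ?n (\<lambda>(i, j). 1)"
  define C :: "complex mat" where "C = map_mat of_int B"
  define D where "D = mat ?n ?n (\<lambda>(i, j). if i = j then 2 / of_nat (d (\<beta> i)) else (0::complex))"
  have carr [simp]: "B \<in> carrier_mat ?n ?n" "R \<in> carrier_mat ?n ?n" "C \<in> carrier_mat ?n ?n"
    "D \<in> carrier_mat ?n ?n" "C\<^sup>T \<in> carrier_mat ?n ?n" "M \<in> carrier_mat ?n ?n"
    by (auto simp: B_def R_def C_def D_def M_def)
  have RB: "R * B = 2 \<cdot>\<^sub>m R"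
  proof (rule eq_matI)
    fix i j assume "i < dim_row (2 \<cdot>\<^sub>m R)" "j < dim_col (2 \<cdot>\<^sub>m R)"
    then have ij: "i < ?n" "j < ?n" by (auto simp: R_def)
    have \<gamma>j: "\<gamma> j \<in> edges" using bij_betwE[OF \<gamma>] ij by simp
    have "(R * B) $$ (i, j) = (\<Sum>l\<in>{0..<?n}. if \<beta> l \<in> \<gamma> j then 1 else 0)"
      unfolding mat_mult_entry[OF carr(2,1) ij] using ij
      by (intro sum.cong) (auto simp: R_def B_def)
    also have "\<dots> = (\<Sum>v\<in>V. if v \<in> \<gamma> j then 1 else 0)"
      by (rule sum.reindex_bij_betw[OF \<beta>])
    also have "\<dots> = int (card (\<gamma> j))"
      using edge_vertices(2)[OF \<gamma>j] finite_V by (simp add: sum.If_cases Int_absorb1)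
    finally show "(R * B) $$ (i, j) = (2 \<cdot>\<^sub>m R) $$ (i, j)"
      using ij edge_vertices(1)[OF \<gamma>j] by (simp add: R_def)
  qed (auto simp: R_def B_def)
  \<comment> \<open>Multiplying R B = 2 R by the adjugate stays over the integers: det B times the
    all-ones matrix \<open>R\<close> equals 2 R adj(B), and any entry shows that det B is
    even.\<close>
  have adj: "adj_mat B \<in> carrier_mat ?n ?n" "B * adj_mat B = det B \<cdot>\<^sub>m 1\<^sub>m ?n"
    using adj_mat[OF carr(1)] by auto
  have "(R * B) * adj_mat B = R * (B * adj_mat B)"
    by (rule assoc_mult_mat[OF carr(2,1) adj(1)])
  then have "2 \<cdot>\<^sub>m (R * adj_mat B) = det B \<cdot>\<^sub>m R"
    using adj by (simp add: RB right_mult_one_mat[OF carr(2)] mult_smult_distrib[OF carr(2) one_carrier_mat] mult_smult_assoc_mat[OF carr(2) adj(1)])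
  then have "(2 \<cdot>\<^sub>m (R * adj_mat B)) $$ (0, 0) = (det B \<cdot>\<^sub>m R) $$ (0, 0)" by simp
  then have "2 * (R * adj_mat B) $$ (0, 0) = det B"
    using n adj(1) by (simp add: R_def)
  then obtain c where c: "det B = 2 * c" by metis
  have detC: "det C = 2 * of_int c"
    unfolding C_def of_int_hom.hom_det c by simp
  have "det D = prod_list (diag_mat D)"
    by (rule det_upper_triangular[OF _ carr(4)]) (auto simp: D_def upper_triangular_def)
  also have "\<dots> = (\<Prod>i\<in>{0..<?n}. 2 / of_nat (d (\<beta> i)))"
    by (simp add: prod_list_diag_prod D_def)
  also have "\<dots> = (\<Prod>v\<in>V. 2 / of_nat (d v))"
    by (rule prod.reindex_bij_betw[OF \<beta>])
  finally have detD: "det D = (\<Prod>v\<in>V. 2 / of_nat (d v))" .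
  have "M = D * (C * C\<^sup>T)"
  proof (rule eq_matI)
    fix i j assume "i < dim_row (D * (C * C\<^sup>T))" "j < dim_col (D * (C * C\<^sup>T))"
    then have ij: "i < ?n" "j < ?n" by (auto simp: D_def C_def B_def)
    have "(C * C\<^sup>T) $$ (i, j) = (\<Sum>l\<in>{0..<?n}. if \<beta> i \<in> \<gamma> l \<and> \<beta> j \<in> \<gamma> l then 1 else 0)"
      unfolding mat_mult_entry[OF carr(3,5) ij] using ij
      by (intro sum.cong) (auto simp: C_def B_def)
    also have "\<dots> = (\<Sum>y\<in>edges. if \<beta> i \<in> y \<and> \<beta> j \<in> y then 1 else 0)"
      by (rule sum.reindex_bij_betw[OF \<gamma>])
    also have "\<dots> = of_nat (card {y \<in> edges. \<beta> i \<in> y \<and> \<beta> j \<in> y})"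
      using finite_edges by (simp add: sum.inter_filter[symmetric])
    also have "\<dots> = (if i = j then of_nat (d (\<beta> i)) else if E (\<beta> i) (\<beta> j) then 1 else 0)"
      using ij by (simp add: card_edges_containing \<beta>_eq)
    finally have CC: "(C * C\<^sup>T) $$ (i, j) = (if i = j then of_nat (d (\<beta> i)) else if E (\<beta> i) (\<beta> j) then 1 else 0)" .
    have "(D * (C * C\<^sup>T)) $$ (i, j) = (\<Sum>l\<in>{0..<?n}. if l = i then 2 / of_nat (d (\<beta> i)) * (C * C\<^sup>T) $$ (i, j) else 0)"
      unfolding mat_mult_entry[OF carr(4) mult_carrier_mat[OF carr(3,5)] ij] using ij
      by (intro sum.cong) (auto simp: D_def)
    also have "\<dots> = 2 / of_nat (d (\<beta> i)) * (C * C\<^sup>T) $$ (i, j)" using ij by simp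
    finally show "M $$ (i, j) = (D * (C * C\<^sup>T)) $$ (i, j)"
      unfolding CC using ij d_pos[OF \<beta>V[OF ij(1)]] E_irrefl by (cases "i = j") (simp_all add: M_def)
  qed (auto simp: M_def D_def C_def B_def)
  then have "det M = det D * (det C * det C)"
    using det_mult[OF carr(4) mult_carrier_mat[OF carr(3,5)]] det_mult[OF carr(3,5)] det_transpose[OF carr(3)] by simp
  then have "det M = (\<Prod>v\<in>V. 2 / of_nat (d v)) * (2 * of_int c)\<^sup>2"
    by (simp add: detD detC power2_eq_square)
  then show ?thesis using that unfolding M_def by blast
qed

end

section \<open>All degrees are two\<close>

context odd_periodic_graph
begin

lemma degree_eq_2:
  assumes "v \<in> V"
  shows "d v = 2"
proof -
  let ?n = "card V" and ?a = "of_nat (card A) :: complex"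
  have n: "?n > 0" using assms finite_V by (auto simp: card_gt_0_iff)
  have a: "?a \<noteq> 0" using arcs_nonempty by simp
  obtain \<beta> where \<beta>: "bij_betw \<beta> {0..<?n} V" using ex_bij_betw_nat_finite[OF finite_V] by auto
  have \<beta>V: "\<beta> i \<in> V" if "i < ?n" for i using bij_betwE[OF \<beta>] that by simp
  have \<beta>_eq: "\<beta> i = \<beta> j \<longleftrightarrow> i = j" if "i < ?n" "j < ?n" for i j
    using \<beta> that by (auto simp: bij_betw_def dest: inj_onD)
  have \<beta>_onto: "\<exists>i<?n. v = \<beta> i" if "v \<in> V" for v
    using bij_betw_imp_surj_on[OF \<beta>] that by force
  \<comment> \<open>The stationary distribution of the simple random walk.\<close>
  define w where "w j = of_nat (d (\<beta> j)) / ?a" for j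
  define M :: "complex mat" where
    "M = mat ?n ?n (\<lambda>(i, j). (if i = j then 2 else 0) + (if E (\<beta> i) (\<beta> j) then 2 / of_nat (d (\<beta> i)) else 0))"
  \<comment> \<open>\<open>W\<close> is the identity on vectors of \<open>w\<close>-weighted sum 0
    and, like \<open>M\<close>, multiplies constants by 4. Hence \<open>X\<close>, the inverse of
    \<open>M\<close> times \<open>W\<close>, inverts \<open>M\<close> on the former and fixes
    constants, which keeps powers of 1/4 out of its iterates.\<close>
  define W where "W = mat ?n ?n (\<lambda>(i, j). (if i = j then 1 else 0) + 3 * w j)"
  define X where "X = inverse (det M) \<cdot>\<^sub>m (adj_mat M * W)"
  have carr [simp]: "M \<in> carrier_mat ?n ?n" "W \<in> carrier_mat ?n ?n" "adj_mat M \<in> carrier_mat ?n ?n" "X \<in> carrier_mat ?n ?n"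
    using adj_mat(1)[of M ?n] by (auto simp: M_def W_def X_def)
  have sumV: "(\<Sum>i\<in>{0..<?n}. g (\<beta> i)) = (\<Sum>v\<in>V. g v)" for g :: "'a \<Rightarrow> complex"
    by (rule sum.reindex_bij_betw[OF \<beta>])
  have sum_w: "(\<Sum>j\<in>{0..<?n}. w j) = 1"
    using sumV[of "\<lambda>v. of_nat (d v) / ?a"] a
    by (simp add: w_def card_arcs flip: sum_divide_distrib)
  have signless_M: "signless p (\<beta> i) = (\<Sum>j\<in>{0..<?n}. M $$ (i, j) * p (\<beta> j))" if i: "i < ?n" for p i
  proof -
    have "signless p (\<beta> i) = 2 * p (\<beta> i) + (\<Sum>u\<in>V. (if E (\<beta> i) u then 2 / of_nat (d (\<beta> i)) else 0) * p u)"
      using finite_V by (simp add: signless_def nb_def sum_distrib_left if_distrib[of "\<lambda>x. x * _"] sum.inter_filter cong: if_cong)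
        (auto intro!: sum.cong)
    also have "\<dots> = (\<Sum>j\<in>{0..<?n}. (if i = j then 2 else 0) * p (\<beta> j) + (if E (\<beta> i) (\<beta> j) then 2 / of_nat (d (\<beta> i)) else 0) * p (\<beta> j))"
      unfolding sum.distrib sumV[of "\<lambda>u. (if E (\<beta> i) u then 2 / of_nat (d (\<beta> i)) else 0) * p u"]
      using i by (simp add: if_distrib[of "\<lambda>x. x * _"] cong: if_cong)
    also have "\<dots> = (\<Sum>j\<in>{0..<?n}. M $$ (i, j) * p (\<beta> j))"
      using i by (intro sum.cong) (auto simp: M_def ring_distribs)
    finally show ?thesis .
  qed
  have detM: "det M \<noteq> 0"
  proof
    assume "det M = 0"
    then obtain x where x: "x \<in> carrier_vec ?n" "x \<noteq> 0\<^sub>v ?n" "M *\<^sub>v x = 0\<^sub>v ?n"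
      using det_0_iff_vec_prod_zero[OF carr(1)] by blast
    define p where "p u = x $ the_inv_into {0..<?n} \<beta> u" for u
    have p: "p (\<beta> i) = x $ i" if "i < ?n" for i
      using \<beta> that by (simp add: p_def bij_betw_def the_inv_into_f_f)
    have "signless p (\<beta> i) = 0" if i: "i < ?n" for i
    proof -
      have "(M *\<^sub>v x) $ i = (\<Sum>j\<in>{0..<?n}. M $$ (i, j) * x $ j)"
        using i x(1) carrier_matD[OF carr(1)] by (auto simp: scalar_prod_def intro!: sum.cong)
      then show ?thesis using i by (simp add: signless_M p x(3))
    qed
    then have "signless p v = 0" if "v \<in> V" for v using \<beta>_onto[OF that] by blast
    then have "x $ i = 0" if "i < ?n" for i
      using signless_inj[of p, OF _ \<beta>V[OF that]] p[OF that] by simp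
    then have "x = 0\<^sub>v ?n"
      using x(1) by (intro eq_vecI) auto
    then show False using x(2) by simp
  qed
  have MX: "M * X = W"
  proof -
    have "M * X = inverse (det M) \<cdot>\<^sub>m (M * adj_mat M * W)"
      unfolding X_def by (simp add: mult_smult_distrib[OF carr(1) mult_carrier_mat[OF carr(3,2)]] assoc_mult_mat[OF carr(1,3,2)])
    also have "M * adj_mat M * W = det M \<cdot>\<^sub>m W"
      using adj_mat(2)[OF carr(1)] by (simp add: mult_smult_assoc_mat[OF one_carrier_mat carr(2)] left_mult_one_mat[OF carr(2)])
    finally have "M * X = inverse (det M) \<cdot>\<^sub>m (det M \<cdot>\<^sub>m W)" .
    then show ?thesis using detM by (intro eq_matI) (simp_all add: W_def)
  qed
  \<comment> \<open>\<open>w\<close> is a left eigenvector of \<open>M\<close> for 4. As 4 w X = w M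
    X = w W = 4 w, it is fixed by \<open>X\<close> and all its powers.\<close>
  have wM: "(\<Sum>i\<in>{0..<?n}. w i * M $$ (i, j)) = 4 * w j" if j: "j < ?n" for j
  proof -
    have "(\<Sum>i\<in>{0..<?n}. w i * M $$ (i, j)) = (\<Sum>i\<in>{0..<?n}. (if i = j then 2 * w j else 0) + (if E (\<beta> i) (\<beta> j) then 2 / ?a else 0))"
    proof (rule sum.cong)
      fix i assume "i \<in> {0..<?n}"
      then have "i < ?n" "of_nat (d (\<beta> i)) \<noteq> (0::complex)" using d_pos \<beta>V by auto
      then show "w i * M $$ (i, j) = (if i = j then 2 * w j else 0) + (if E (\<beta> i) (\<beta> j) then 2 / ?a else 0)"
        using j a by (auto simp: M_def w_def field_simps)
    qed simp
    also have "\<dots> = 2 * w j + (\<Sum>v\<in>V. if E v (\<beta> j) then 2 / ?a else 0)"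
      using j sumV[of "\<lambda>v. if E v (\<beta> j) then 2 / ?a else 0"] by (simp add: sum.distrib)
    also have "(\<Sum>v\<in>V. if E v (\<beta> j) then 2 / ?a else 0) = (\<Sum>v\<in>nb (\<beta> j). 2 / ?a)"
    proof -
      have "nb (\<beta> j) = {v \<in> V. E v (\<beta> j)}" using E_sym by (auto simp: nb_def)
      then show ?thesis using finite_V by (simp only: sum.inter_filter)
    qed
    finally show ?thesis by (simp add: w_def d_eq_card)
  qed
  have wX: "(\<Sum>i\<in>{0..<?n}. w i * X $$ (i, l)) = w l" if l: "l < ?n" for l
  proof -
    have "4 * (\<Sum>j\<in>{0..<?n}. w j * X $$ (j, l)) = (\<Sum>j\<in>{0..<?n}. (\<Sum>i\<in>{0..<?n}. w i * M $$ (i, j)) * X $$ (j, l))"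
      by (simp add: wM sum_distrib_left mult.assoc)
    also have "\<dots> = (\<Sum>j\<in>{0..<?n}. \<Sum>i\<in>{0..<?n}. w i * (M $$ (i, j) * X $$ (j, l)))"
      by (simp add: sum_distrib_right mult.assoc)
    also have "\<dots> = (\<Sum>i\<in>{0..<?n}. w i * (M * X) $$ (i, l))"
      by (subst sum.swap) (simp add: mat_mult_entry[OF carr(1,4) _ l] sum_distrib_left del: index_mult_mat)
    also have "\<dots> = (\<Sum>i\<in>{0..<?n}. (if i = l then w l else 0) + w i * (3 * w l))"
      unfolding MX using l by (intro sum.cong) (auto simp: W_def ring_distribs)
    also have "\<dots> = 4 * w l"
      using l by (simp add: sum.distrib sum_w flip: sum_distrib_right)
    finally show ?thesis by simp
  qed
  define P where "P j = ((\<lambda>Y. X * Y) ^^ j) (1\<^sub>m ?n)" for j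
  have P0: "P 0 = 1\<^sub>m ?n" and PS: "P (Suc j) = X * P j" for j by (simp_all add: P_def)
  have Pc [simp]: "P j \<in> carrier_mat ?n ?n" for j
    by (induction j) (auto simp: P0 PS intro!: mult_carrier_mat[OF carr(4)])
  have detP: "det (P j) = det X ^ j" for j
    by (induction j) (simp_all add: P0 PS det_mult[OF carr(4) Pc])
  have wP: "(\<Sum>i\<in>{0..<?n}. w i * P j $$ (i, l)) = w l" if l: "l < ?n" for j l
  proof (induction j)
    case 0
    then show ?case using l by (simp add: P0 if_distrib[of "\<lambda>x. _ * x"] cong: if_cong)
  next
    case (Suc j)
    have "(\<Sum>i\<in>{0..<?n}. w i * P (Suc j) $$ (i, l)) = (\<Sum>i\<in>{0..<?n}. \<Sum>m\<in>{0..<?n}. w i * X $$ (i, m) * P j $$ (m, l))"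
      unfolding PS by (simp add: mat_mult_entry[OF carr(4) Pc _ l] sum_distrib_left mult.assoc del: index_mult_mat)
    also have "\<dots> = (\<Sum>m\<in>{0..<?n}. (\<Sum>i\<in>{0..<?n}. w i * X $$ (i, m)) * P j $$ (m, l))"
      by (subst sum.swap) (simp add: sum_distrib_right)
    also have "\<dots> = w l" by (simp add: wX Suc)
    finally show ?case .
  qed
  have MP: "(\<Sum>m\<in>{0..<?n}. M $$ (i, m) * P (Suc j) $$ (m, l)) = P j $$ (i, l) + 3 * w l" if i: "i < ?n" and l: "l < ?n" for i j l
  proof -
    have "(\<Sum>m\<in>{0..<?n}. M $$ (i, m) * P (Suc j) $$ (m, l)) = (M * (X * P j)) $$ (i, l)"
      unfolding PS by (rule mat_mult_entry[OF carr(1) mult_carrier_mat[OF carr(4) Pc] i l, symmetric])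
    also have "\<dots> = (W * P j) $$ (i, l)"
      by (simp only: assoc_mult_mat[OF carr(1,4) Pc, symmetric] MX)
    also have "\<dots> = (\<Sum>m\<in>{0..<?n}. (if m = i then P j $$ (i, l) else 0) + 3 * (w m * P j $$ (m, l)))"
      unfolding mat_mult_entry[OF carr(2) Pc i l] using i l
      by (intro sum.cong) (auto simp: W_def ring_distribs)
    also have "\<dots> = P j $$ (i, l) + 3 * w l"
      using i l by (simp add: sum.distrib wP flip: sum_distrib_left)
    finally show ?thesis .
  qed
  obtain N where N: "N > 0" and
    lat: "\<And>c p. (\<And>v. v \<in> V \<Longrightarrow> of_nat c * p v \<in> \<int>) \<Longrightarrow> lattice (of_nat (N * c)) (at_terminus p)"
    using lattice_exists by blast
  \<comment> \<open>N clears the denominators of the powers of U, and \<open>card A\<close> those of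
    \<open>w\<close>.\<close>
  define K where "K = N * card A"
  \<comment> \<open>Column l of X^j with its weighted mean \<open>w l\<close> removed, so that
    \<open>lattice_signless\<close> applies to it.\<close>
  define q where "q j l u = P j $$ (the_inv_into {0..<?n} \<beta> u, l) - w l" for j l u
  have q: "q j l (\<beta> i) = P j $$ (i, l) - w l" if "i < ?n" for j l i
    using \<beta> that by (simp add: q_def bij_betw_def the_inv_into_f_f)
  have q_zero: "(\<Sum>v\<in>V. of_nat (d v) * q j l v) = 0" if l: "l < ?n" for j l
  proof -
    have "(\<Sum>v\<in>V. of_nat (d v) * q j l v) = (\<Sum>i\<in>{0..<?n}. ?a * (w i * P j $$ (i, l) - w i * w l))"
      unfolding sumV[symmetric] using a by (intro sum.cong) (auto simp: q w_def right_diff_distrib)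
    also have "\<dots> = ?a * (w l - w l)"
      by (simp add: sum_subtractf wP[OF l] sum_w flip: sum_distrib_left sum_distrib_right)
    finally show ?thesis by simp
  qed
  \<comment> \<open>Since 2 + 2P maps \<open>q (Suc j) l\<close> to \<open>q j l\<close>, the
    denominator K serves for all j.\<close>
  have q_lat: "lattice (of_nat K) (at_terminus (q j l))" if l: "l < ?n" for j l
  proof (induction j)
    case 0
    show ?case unfolding K_def
    proof (rule lat)
      fix v assume "v \<in> V"
      then obtain i where i: "i < ?n" "v = \<beta> i" using \<beta>_onto by blast
      have "?a * q 0 l v = of_int ((if i = l then int (card A) else 0) - int (d (\<beta> l)))"
        using i l a by (simp add: q P0 w_def right_diff_distrib)
      then show "?a * q 0 l v \<in> \<int>" by (metis Ints_of_int)
    qed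
  next
    case (Suc j)
    show ?case
    proof (rule lattice_signless[OF Suc q_zero[OF l]])
      fix v assume "v \<in> V"
      then obtain i where i: "i < ?n" "v = \<beta> i" using \<beta>_onto by blast
      have "signless (q (Suc j) l) v = (\<Sum>m\<in>{0..<?n}. M $$ (i, m) * P (Suc j) $$ (m, l)) - (\<Sum>m\<in>{0..<?n}. M $$ (i, m) * w l)"
        using i by (simp add: signless_M q right_diff_distrib sum_subtractf)
      also have "(\<Sum>m\<in>{0..<?n}. M $$ (i, m) * w l) = signless (\<lambda>_. w l) v"
        using i by (simp add: signless_M)
      also have "\<dots> = 4 * w l"
        using d_pos[OF \<open>v \<in> V\<close>] by (auto simp: signless_def d_eq_card)
      finally show "signless (q (Suc j) l) v = q j l v"
        using i l by (simp add: MP q)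
    qed
  qed
  have P_int: "of_nat K * P j $$ (i, l) \<in> \<int>" if i: "i < ?n" and l: "l < ?n" for i j l
  proof -
    have "of_nat K * q j l (\<beta> i) \<in> \<int>" by (rule lattice_vertex[OF q_lat[OF l] \<beta>V[OF i]])
    moreover have "of_nat K * w l = of_nat (N * d (\<beta> l))" using a by (simp add: K_def w_def)
    ultimately have "of_nat K * q j l (\<beta> i) + of_nat (N * d (\<beta> l)) \<in> \<int>" by (intro Ints_add) auto
    also have "of_nat K * q j l (\<beta> i) + of_nat (N * d (\<beta> l)) = of_nat K * P j $$ (i, l)"
      unfolding \<open>of_nat K * w l = of_nat (N * d (\<beta> l))\<close>[symmetric] using i by (simp add: q right_diff_distrib)
    finally show ?thesis .
  qed
  have X_int: "of_nat K ^ ?n * det X ^ j \<in> \<int>" for j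
  proof -
    have "det (of_nat K \<cdot>\<^sub>m P j) \<in> \<int>"
      by (rule det_in_Ints[of _ ?n]) (use P_int carrier_matD[OF Pc] in auto)
    then show ?thesis using carrier_matD[OF Pc] by (simp add: detP)
  qed
  obtain c :: int where c: "det M = (\<Prod>v\<in>V. 2 / of_nat (d v)) * (2 * of_int c)\<^sup>2"
    unfolding M_def by (rule signless_det[OF \<beta> card_arcs_eq])
  have "det W = 4"
    unfolding W_def using det_add_rank_one[OF n, of "\<lambda>j. 3 * w j"] sum_w by (simp flip: sum_distrib_left)
  then have "det M * det X = 4" using det_mult[OF carr(1,4)] MX by simp
  have c0: "c \<noteq> 0" using detM c by auto
  let ?D = "\<Prod>v\<in>V. d v"
  have D: "?D > 0" using d_pos by (simp add: prod_pos)
  have M2: "det M * of_nat ?D = 2 ^ ?n * 4 * of_int c ^ 2"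
  proof -
    have "(\<Prod>v\<in>V. 2 / of_nat (d v)) * of_nat ?D = (\<Prod>v\<in>V. 2 :: complex)"
      unfolding of_nat_prod prod.distrib[symmetric] using d_pos by (intro prod.cong) auto
    then show ?thesis by (simp add: c power2_eq_square mult_ac)
  qed
  \<comment> \<open>From det M det X = 4 and the factorization of det M, this is det X as a real
    number.\<close>
  define \<rho> :: real where "\<rho> = real ?D / (2 ^ ?n * of_int c ^ 2)"
  have "det X * (2 ^ ?n * of_int c ^ 2) = of_nat ?D"
  proof -
    have "4 * (det X * (2 ^ ?n * of_int c ^ 2)) = det X * (det M * of_nat ?D)" unfolding M2 by simp
    also have "\<dots> = 4 * of_nat ?D" using \<open>det M * det X = 4\<close> by (metis mult.assoc mult.commute)
    finally show ?thesis by simp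
  qed
  then have \<rho>: "det X = of_real \<rho>" using c0 by (simp add: \<rho>_def field_simps)
  \<comment> \<open>The determinants of K X^j are integers for all j, so det X cannot be below 1;
    hence the product of the degrees is at least 2^n c^2, where c is a nonzero integer.\<close>
  have "\<rho> \<ge> 1"
  proof (rule one_le_of_integral_powers[of \<rho> "real K ^ ?n"])
    show "\<rho> > 0" using D c0 by (simp add: \<rho>_def del: of_nat_prod)
    show "real K ^ ?n > 0" using N arcs_nonempty by (simp add: K_def card_gt_0_iff)
    fix j
    have "of_real (real K ^ ?n * \<rho> ^ j) \<in> (\<int> :: complex set)" using X_int[of j] by (simp add: \<rho>)
    then show "real K ^ ?n * \<rho> ^ j \<in> \<int>" by (metis Ints_cases Ints_of_int of_real_eq_iff of_real_of_int_eq)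
  qed
  then have "2 ^ ?n * of_int c ^ 2 \<le> real ?D" using c0 by (simp add: \<rho>_def field_simps del: of_nat_prod)
  moreover have "(1::real) \<le> of_int c ^ 2"
  proof -
    have "1 \<le> c ^ 2" using c0 by (simp add: int_one_le_iff_zero_less)
    then show ?thesis by (simp flip: of_int_power)
  qed
  ultimately have "2 ^ ?n * 1 \<le> real ?D"
    by (meson mult_left_mono order_trans zero_le_numeral zero_le_power)
  then have "2 ^ ?n \<le> ?D" by (metis mult.right_neutral of_nat_le_iff of_nat_numeral of_nat_power)
  then show ?thesis
    using d_pos card_arcs card_arcs_eq by (intro eq_2_of_prod_ge[OF finite_V _ _ _ assms]) auto
qed

end

theorem theorem2p5:
  fixes V :: "'a set" and E :: "'a \<Rightarrow> 'a \<Rightarrow> bool" and k :: nat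
  assumes "odd k" and "k \<ge> 3"
    and "simple_graph V E" and "connected_graph V E"
  shows "k_periodic V E k \<longleftrightarrow> is_cycle_graph V E k"
proof
  assume k: "k_periodic V E k"
  have per: "periodic V E" and k_eq: "period V E = k" using k by (auto simp: k_periodic_def)
  have id: "grover_pow_is_id V E k"
    using LeastI_ex[OF per[unfolded periodic_def]] k_eq unfolding period_def by simp
  \<comment> \<open>Without arcs the identity condition holds vacuously already for exponent 1,
    contradicting k at least 3.\<close>
  have "arcs V E \<noteq> {}"
  proof
    assume "arcs V E = {}"
    then have "period V E \<le> 1"
      unfolding period_def by (intro Least_le) (simp add: grover_pow_is_id_def)
    then show False using k_eq assms(2) by simp
  qed
  then interpret odd_periodic_graph V E k
    using assms id by unfold_locales
  \<comment> \<open>The length n of the cycle is so far unrelated to k; it equals k because C_n has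
    period n.\<close>
  obtain n where n: "n \<ge> 3" "is_cycle_graph V E n"
    using two_regular_cycle_graph degree_eq_2 by blast
  then have "k_periodic V E n" using cycle_graph_period assms by blast
  then show "is_cycle_graph V E k" using n k_eq by (simp add: k_periodic_def)
qed (use cycle_graph_period assms in blast)

end
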